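(* Let $L = T \cup T'$ be an oriented virtual link that has been decomposed into the $n$-tangles $T$ and $T'$. Then $$f(T \cup T') = \sum_{m \in \mathcal{P}_n} q_m \, f(\widetilde{T}^B(m)),$$ where the $q_m \in \mathbb{Z}[A,A^{-1}]$ are Laurent polynomials that depend on the (oriented) tangle $T'$ and not on the internal structure of $T$.
   Context: **Bracket and auxiliary polynomial.** Virtual link diagrams have classical and virtual crossings. The Kauffman bracket $\langle D\rangle\in\mathbb{Z}[A,A^{-1}]$ of an unoriented virtual link diagram is defined by: (i) at a classical crossing, drawn so that the over-strand runs from bottom left to top right, $\langle D\rangle = A\langle D_A\rangle + A^{-1}\langle D_B\rangle$, where $D_A$ replaces the crossing by two arcs, one joining the two left ends and one joining the two right ends, and $D_B$ replaces it by two arcs, one joining the two top ends and one joining the two bottom ends; (ii) $\langle \bigcirc\sqcup D\rangle = (-A^2-A^{-2})\langle D\rangle$; (iii) $\langle\bigcirc\rangle=1$ (virtual crossings are not smoothed; a state curve with only virtual crossings counts as $\bigcirc$). For an oriented diagram, the auxiliary polynomial is $f(D)=(-A^3)^{-w(D)}\langle D\rangle$, where $w$ is the writhe (sum of signs of classical crossings); it is an invariant of oriented virtual links and yields the Jones polynomial at $A=t^{-1/4}$. **Tangles.** An $n$-tangle is a (virtual) tangle diagram in a disk with $2n$ endpoints on the boundary circle; closed components are allowed. Its $i$-th endpoint is at angle $-\pi i/n$ (so endpoints $1,\dots,2n$ are in clockwise order). $L=T\cup T'$ means that the diagram of $L$ is obtained by gluing the $i$-th endpoint of $T$ to the $i$-th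 endpoint of the complementary $n$-tangle $T'$ for every $i$. **Matchings and closures.** $\mathcal{P}_n$ is the set of partitions of $\{1,\dots,2n\}$ into $n$ pairs, each drawn as a matching of the points at angles $-\pi i/n$ on the unit circle by arcs in the disk, no two arcs meeting more than once and no three at a common point. The closure $T(m)$ of $T$ by $m\in\mathcal{P}_n$ is obtained by inverting the arcs of $m$ across the unit circle, turning all their intersections into virtual crossings, and attaching the $i$-th endpoint of $m$ to the $i$-th endpoint of $T$. **Orientation braid.** Let $T$ have orientation $\vec v$, a word of length $2n$ with $n$ letters $+$ and $n$ letters $-$, where $v_i=+$ iff the $i$-th endpoint of $T$ is outbound. The braid $B_{\vec v}$ on $2n$ strands is built as follows, starting from the empty word. (1) Let $s$ be the longest initial subword of $\vec v$ of the form $(+-)^k$ or $(+-)^k+$. (2) If $|s|=2n$, stop. Otherwise let $j>|s|$ be the smallest index with $v_j\ne v_{|s|+1}$ and append $\sigma_{j-1}\sigma_{j-2}\cdots\sigma_{|s|+1}$ to the end of $B_{\vec v}$. (3) Replace $\vec v$ by $\vec v\,'$ with $v'_{|s|+1}=v_j$, $v'_i=v_{i-1}$ for $|s|+2\le i\le j$, and $v'_i=v_i$ otherwise; return to (1). Braids are drawn from bottom to top (first letter at the bottom), and in $\sigma_i$ the strand going from bottom position $i+1$ to top position $i$ passes over the other. $T^B$ is the $n$-tangle obtained by gluing the $i$-th endpoint of $T$ to the bottom of the $i$-th strand of $B_{\vec v}$; its endpoints (tops of the strands) have orientation $(+-)^n$ ("standard orientation"). $T^B(m)$ is the closure of $T^B$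 by $m$. **Modified closures.** $\widetilde{T}^B(m)$ is obtained from $T^B(m)$ by modifying every virtual crossing in $T^B(m)-T^B$: suppose its four ends lead to endpoints $a_1<a_2<a_3<a_4$ of $T^B$, drawn with $a_1$ at top right, $a_2$ at bottom right, $a_3$ at bottom left, $a_4$ at top left. Below the virtual crossing, on the two ends leading to $a_2$ and $a_3$, insert a classical crossing in which the strand coming from the $a_3$ end (bottom left, running to upper right) passes over the strand coming from the $a_2$ end; the virtual crossing is kept above it. (Thus the over-strand then joins the $a_3$ end to the $a_4$ end and the under-strand joins the $a_2$ end to the $a_1$ end.) If $m$ has no crossings, $\widetilde T^B(m)=T^B(m)$. The links $\widetilde T^B(m)$ are oriented compatibly with the given orientation of $T$. *)

theory Defs
  imports "HOL-Library.Poly_Mapping" "HOL-Library.Disjoint_Sets" "HOL-Library.Multiset"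
begin

section \<open>Laurent polynomials\<close>

text \<open>The group ring of the integers, that is, \<open>\<int>[A, A\<^sup>-\<^sup>1]\<close>.\<close>

type_synonym laurent = "int \<Rightarrow>\<^sub>0 int"

definition A_pow :: "int \<Rightarrow> laurent" where
  "A_pow k = Poly_Mapping.single k 1"

definition loop_value :: laurent where
  "loop_value = - A_pow 2 - A_pow (- 2)"

section \<open>Virtual tangle and link diagrams\<close>

text \<open>
  A planar diagram in general position with respect to the height function is read from bottom to
  top; every critical level contributes one letter.  Strands at a given level are numbered
  \<open>0, 1, \<dots>\<close> from the left, and each letter acts at positions \<open>i\<close> and \<open>i + 1\<close>: a local minimum
  \<open>Cup\<close>, a local maximum \<open>Cap\<close>, a virtual crossing \<open>Virt\<close>, a classical crossing \<open>Cross_R\<close> whose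
  over-strand runs from bottom left to top right, and a classical crossing \<open>Cross_L\<close> whose
  over-strand runs from bottom right to top left.  Composition of words puts the later word on top.

  A local minimum carries a label: nothing for an unoriented diagram, and for an oriented diagram
  whether its left end points upwards.  This, together with the directions of the strands at the
  bottom, determines the orientation.

  An \<open>n\<close>-tangle in a disk is a word from 0 to \<open>2n\<close> strands, and a complementary \<open>n\<close>-tangle is a
  word from \<open>2n\<close> to 0 strands: the boundary circle is cut open between the last and the first
  endpoint, the disk becoming the lower and its complement the upper half plane.  Walking
  clockwise along the circle, with the disk on the right, becomes walking from left to right, so
  the endpoints \<open>1, \<dots>, 2n\<close> are the positions \<open>0, \<dots>, 2n - 1\<close>.  Gluing is concatenation of words,
  and a link diagram is a word from 0 to 0 strands.
\<close>

datatype 'a letter = Cup 'a nat | Cap nat | Virt nat | Cross_R nat | Cross_L nat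

type_synonym diagram = "unit letter list"

type_synonym oriented_diagram = "bool letter list"

definition forget :: "oriented_diagram \<Rightarrow> diagram" where
  "forget w = map (map_letter (\<lambda>_. ())) w"

fun width_after :: "'a letter \<Rightarrow> nat \<Rightarrow> nat" where
  "width_after (Cup _ i) k = k + 2"
| "width_after (Cap i) k = k - 2"
| "width_after _ k = k"

fun admissible :: "nat \<Rightarrow> 'a letter \<Rightarrow> bool" where
  "admissible k (Cup _ i) \<longleftrightarrow> i \<le> k"
| "admissible k (Cap i) \<longleftrightarrow> i + 1 < k"
| "admissible k (Virt i) \<longleftrightarrow> i + 1 < k"
| "admissible k (Cross_R i) \<longleftrightarrow> i + 1 < k"
| "admissible k (Cross_L i) \<longleftrightarrow> i + 1 < k"

fun tangle :: "nat \<Rightarrow> 'a letter list \<Rightarrow> nat \<Rightarrow> bool" where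
  "tangle k [] l \<longleftrightarrow> k = l"
| "tangle k (x # w) l \<longleftrightarrow> admissible k x \<and> tangle (width_after x k) w l"

subsection \<open>Orientations\<close>

text \<open>
  The directions of the strands at a level form a word in which \<open>True\<close> (the letter \<open>+\<close>) stands for
  an upward strand.  At the top of a tangle below the level, upward means outbound.
\<close>

fun orient_after :: "bool letter \<Rightarrow> bool list \<Rightarrow> bool list" where
  "orient_after (Cup b i) v = take i v @ [b, \<not> b] @ drop i v"
| "orient_after (Cap i) v = take i v @ drop (i + 2) v"
| "orient_after (Virt i) v = v[i := v ! (i + 1), i + 1 := v ! i]"
| "orient_after (Cross_R i) v = v[i := v ! (i + 1), i + 1 := v ! i]"
| "orient_after (Cross_L i) v = v[i := v ! (i + 1), i + 1 := v ! i]"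

fun oriented_tangle :: "bool list \<Rightarrow> oriented_diagram \<Rightarrow> bool list \<Rightarrow> bool" where
  "oriented_tangle v [] v' \<longleftrightarrow> v = v'"
| "oriented_tangle v (x # w) v' \<longleftrightarrow>
     admissible (length v) x \<and> (\<forall>i. x = Cap i \<longrightarrow> v ! i \<noteq> v ! (i + 1)) \<and>
     oriented_tangle (orient_after x v) w v'"

fun crossing_sign :: "bool letter \<Rightarrow> bool list \<Rightarrow> int" where
  "crossing_sign (Cross_R i) v = (if v ! i = v ! (i + 1) then 1 else - 1)"
| "crossing_sign (Cross_L i) v = (if v ! i = v ! (i + 1) then - 1 else 1)"
| "crossing_sign _ v = 0"

fun writhe_from :: "bool list \<Rightarrow> oriented_diagram \<Rightarrow> int" where
  "writhe_from v [] = 0"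
| "writhe_from v (x # w) = crossing_sign x v + writhe_from (orient_after x v) w"

definition writhe :: "oriented_diagram \<Rightarrow> int" where
  "writhe w = writhe_from [] w"

subsection \<open>Strands\<close>

text \<open>
  The point \<open>(h, j)\<close> is the \<open>j\<close>-th strand at level \<open>h\<close>, just below the letter with index \<open>h\<close>.
  The index \<open>j\<close> is not bounded in \<open>arcs\<close>; strands beyond the width of the diagram
  are never connected to strands within it.
\<close>

type_synonym point = "nat \<times> nat"

fun arcs :: "nat \<Rightarrow> 'a letter \<Rightarrow> (point \<times> point) set" where
  "arcs h (Cup _ i) = {((h + 1, i), (h + 1, i + 1))}
     \<union> {((h, j), (h + 1, j)) | j. j < i} \<union> {((h, j), (h + 1, j + 2)) | j. i \<le> j}"
| "arcs h (Cap i) = {((h, i), (h, i + 1))}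
     \<union> {((h, j), (h + 1, j)) | j. j < i} \<union> {((h, j + 2), (h + 1, j)) | j. i \<le> j}"
| "arcs h (Virt i) = {((h, i), (h + 1, i + 1)), ((h, i + 1), (h + 1, i))}
     \<union> {((h, j), (h + 1, j)) | j. j \<noteq> i \<and> j \<noteq> i + 1}"
| "arcs h (Cross_R i) = {((h, i), (h + 1, i + 1)), ((h, i + 1), (h + 1, i))}
     \<union> {((h, j), (h + 1, j)) | j. j \<noteq> i \<and> j \<noteq> i + 1}"
| "arcs h (Cross_L i) = {((h, i), (h + 1, i + 1)), ((h, i + 1), (h + 1, i))}
     \<union> {((h, j), (h + 1, j)) | j. j \<noteq> i \<and> j \<noteq> i + 1}"

definition all_arcs :: "'a letter list \<Rightarrow> (point \<times> point) set" where
  "all_arcs w = (\<Union>h<length w. arcs h (w ! h))"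

definition connected_by :: "(point \<times> point) set \<Rightarrow> (point \<times> point) set" where
  "connected_by R = (R \<union> R\<inverse>)\<^sup>*"

text \<open>The points of a diagram whose bottom has \<open>k\<close> strands.\<close>

definition points :: "nat \<Rightarrow> 'a letter list \<Rightarrow> point set" where
  "points k w = {(h, j). h \<le> length w \<and> j < fold width_after (take h w) k}"

definition num_components :: "'a letter list \<Rightarrow> nat" where
  "num_components w = card (points 0 w // connected_by (all_arcs w))"

section \<open>Kauffman bracket and auxiliary polynomial\<close>

text \<open>
  \<open>bracket_from u w\<close> is the bracket of \<open>u @ w\<close> where \<open>u\<close> has no classical crossings.  The first
  classical crossing is smoothed: one smoothing leaves two vertical strands (the letter is
  deleted), the other one is a local maximum below a local minimum.  The smoothing with
  coefficient \<open>A\<close> is the vertical one for \<open>Cross_R\<close> and, after turning the picture by a right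
  angle, the horizontal one for \<open>Cross_L\<close>.
\<close>

fun bracket_from :: "diagram \<Rightarrow> diagram \<Rightarrow> laurent" where
  "bracket_from u [] = loop_value ^ (num_components u - 1)"
| "bracket_from u (Cross_R i # w) =
     A_pow 1 * bracket_from u w + A_pow (- 1) * bracket_from (u @ [Cap i, Cup () i]) w"
| "bracket_from u (Cross_L i # w) =
     A_pow 1 * bracket_from (u @ [Cap i, Cup () i]) w + A_pow (- 1) * bracket_from u w"
| "bracket_from u (x # w) = bracket_from (u @ [x]) w"

definition bracket :: "diagram \<Rightarrow> laurent" where
  "bracket w = bracket_from [] w"

lemma bracket_from_skein:
  "bracket_from p (u @ Cross_R i # w) =
     A_pow 1 * bracket_from p (u @ w) + A_pow (- 1) * bracket_from p (u @ [Cap i, Cup () i] @ w)"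
  "bracket_from p (u @ Cross_L i # w) =
     A_pow 1 * bracket_from p (u @ [Cap i, Cup () i] @ w) + A_pow (- 1) * bracket_from p (u @ w)"
proof (induction u arbitrary: p)
  case (Cons x u)
  have lin: "a * (c * y + d * y') + b * (c * z + d * z') = c * (a * y + b * z) + d * (a * y' + b * z')"
    for a b c d y y' z z' :: laurent
    by (simp only: distrib_left ac_simps)
  { case 1 show ?case
      by (cases x; simp only: append_Cons bracket_from.simps Cons.IH(1)) (rule lin)+ }
  { case 2 show ?case
      by (cases x; simp only: append_Cons bracket_from.simps Cons.IH(2)) (rule lin)+ }
qed simp_all

lemma bracket_skein:
  "bracket (u @ Cross_R i # w) =
     A_pow 1 * bracket (u @ w) + A_pow (- 1) * bracket (u @ [Cap i, Cup () i] @ w)"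
  "bracket (u @ Cross_L i # w) =
     A_pow 1 * bracket (u @ [Cap i, Cup () i] @ w) + A_pow (- 1) * bracket (u @ w)"
  unfolding bracket_def by (rule bracket_from_skein)+

text \<open>The first factor of \<open>f\<close> is \<open>(- A\<^sup>3)\<close> to the power \<open>- writhe w\<close>.\<close>

definition aux_poly :: "oriented_diagram \<Rightarrow> laurent" where
  "aux_poly w =
     Poly_Mapping.single (- 3 * writhe w) (if even (writhe w) then 1 else - 1) * bracket (forget w)"

section \<open>The orientation braid\<close>

definition standard :: "nat \<Rightarrow> bool list" where
  "standard n = map even [0..<2 * n]"

text \<open>The length of the longest initial subword of the form \<open>(+-)\<^sup>k\<close> or \<open>(+-)\<^sup>k+\<close>.\<close>

definition alt_len :: "bool list \<Rightarrow> nat" where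
  "alt_len v = (GREATEST p. p \<le> length v \<and> (\<forall>i<p. v ! i = even i))"

text \<open>Moves the entry at position \<open>j\<close> to position \<open>p\<close>, where \<open>p \<le> j\<close>.\<close>

definition move_entry :: "nat \<Rightarrow> nat \<Rightarrow> 'a list \<Rightarrow> 'a list" where
  "move_entry p j v = take p v @ [v ! j] @ drop p (take j v) @ drop (j + 1) v"

lemma alt_len_prop:
  "alt_len v \<le> length v \<and> (\<forall>i<alt_len v. v ! i = even i)"
  unfolding alt_len_def
  by (rule GreatestI_nat[where b = "length v" and k = 0]) auto

lemma alt_len_ge:
  "p \<le> length v \<Longrightarrow> \<forall>i<p. v ! i = even i \<Longrightarrow> p \<le> alt_len v"
  unfolding alt_len_def
  by (rule Greatest_le_nat[where b = "length v"]) auto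

lemma alt_len_move_entry:
  assumes "alt_len v < j" "j < length v" "v ! j \<noteq> v ! alt_len v"
  shows "alt_len v < alt_len (move_entry (alt_len v) j v)"
    and "length (move_entry (alt_len v) j v) = length v"
proof -
  let ?p = "alt_len v"
  let ?w = "move_entry ?p j v"
  show len: "length ?w = length v"
    using assms by (simp add: move_entry_def)
  have "v ! ?p \<noteq> even ?p"
  proof
    assume "v ! ?p = even ?p"
    then have "Suc ?p \<le> alt_len v"
      using assms alt_len_prop[of v] by (intro alt_len_ge) (auto simp: less_Suc_eq)
    then show False by simp
  qed
  then have "v ! j = even ?p" using assms(3) by simp
  then have "\<forall>i<Suc ?p. ?w ! i = even i"
    using assms alt_len_prop[of v] by (auto simp: move_entry_def nth_append less_Suc_eq)
  then have "Suc ?p \<le> alt_len ?w"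
    using len assms by (intro alt_len_ge) auto
  then show "?p < alt_len ?w" by simp
qed

text \<open>
  The braid generator \<open>\<sigma>\<^sub>k\<close> is \<open>Cross_L (k - 1)\<close>.  With \<open>p = |s|\<close> and \<open>j\<close> counted from 0, the word
  appended in each round is \<open>\<sigma>\<^sub>j \<dots> \<sigma>\<^sub>p\<^sub>+\<^sub>1\<close>.  For words with equally many letters of both kinds the
  index \<open>j\<close> always exists.
\<close>

function orientation_braid :: "bool list \<Rightarrow> oriented_diagram" where
  "orientation_braid v =
     (let p = alt_len v; j = (LEAST j. p < j \<and> j < length v \<and> v ! j \<noteq> v ! p) in
      if \<exists>j. p < j \<and> j < length v \<and> v ! j \<noteq> v ! p
      then map Cross_L (rev [p..<j]) @ orientation_braid (move_entry p j v)
      else [])"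
  by auto
termination
proof (relation "measure (\<lambda>v. length v - alt_len v)", simp, goal_cases)
  case (1 v p j)
  have "alt_len v < j \<and> j < length v \<and> v ! j \<noteq> v ! alt_len v"
    using LeastI_ex[OF 1(3)] 1(1,2) by blast
  then show ?case
    using alt_len_move_entry[of v j] 1(1) by auto
qed

declare orientation_braid.simps [simp del]

lemma oriented_tangle_append:
  "oriented_tangle u w v \<Longrightarrow> oriented_tangle v w' v' \<Longrightarrow> oriented_tangle u (w @ w') v'"
  by (induction w arbitrary: u) auto

lemma length_move_entry: "p \<le> j \<Longrightarrow> j < length v \<Longrightarrow> length (move_entry p j v) = length v"
  by (simp add: move_entry_def)

lemma nth_move_entry:
  assumes "p \<le> j" "j < length v" "i < length v"
  shows "move_entry p j v ! i =
    (if i < p then v ! i else if i = p then v ! j else if i \<le> j then v ! (i - 1) else v ! i)"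
proof -
  have "p < i \<Longrightarrow> i \<le> j \<Longrightarrow> p + (i - Suc p) = i - 1" by simp
  then show ?thesis
    using assms by (auto simp: move_entry_def nth_append nth_Cons' min_def)
qed

lemma oriented_tangle_move:
  "p \<le> j \<Longrightarrow> j < length v \<Longrightarrow> oriented_tangle v (map Cross_L (rev [p..<j])) (move_entry p j v)"
proof (induction j arbitrary: v)
  case 0
  then show ?case by (cases v) (auto simp: move_entry_def)
next
  case (Suc j)
  show ?case
  proof (cases "p = Suc j")
    case True
    then show ?thesis using Suc.prems by (auto simp: move_entry_def id_take_nth_drop[symmetric])
  next
    case False
    let ?v = "v[j := v ! Suc j, Suc j := v ! j]"
    have p: "p \<le> j" using False Suc.prems by simp
    have "move_entry p j ?v ! i = move_entry p (Suc j) v ! i" if "i < length v" for i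
    proof -
      consider "i < p" | "i = p" | "p < i" "i \<le> j" | "i = Suc j" | "Suc j < i" by linarith
      then show ?thesis
        using p Suc.prems that by cases (simp_all add: nth_move_entry)
    qed
    then have "move_entry p j ?v = move_entry p (Suc j) v"
      using p Suc.prems by (intro nth_equalityI) (simp_all add: length_move_entry)
    then show ?thesis using Suc.IH[of ?v] p Suc.prems by simp
  qed
qed

lemma mset_move_entry:
  assumes "p \<le> j" "j < length v" shows "mset (move_entry p j v) = mset v"
proof -
  have "v = take p v @ drop p (take j v) @ [v ! j] @ drop (j + 1) v"
    using assms by (metis Suc_eq_plus1 append.assoc append_Cons append_Nil append_take_drop_id id_take_nth_drop min.absorb1 take_take)
  then have "mset v = mset (take p v) + mset (drop p (take j v)) + {#v ! j#} + mset (drop (j+1) v)"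
    by (metis mset_append add.assoc mset_single_iff_right)
  then show ?thesis unfolding move_entry_def by simp
qed

lemma card_evens: "card {i. i < p \<and> even i} = (p + 1) div 2"
proof (induction p)
  case (Suc p)
  have "{i. i < Suc p \<and> even i} = (if even p then insert p {i. i < p \<and> even i} else {i. i < p \<and> even i})"
    by (auto simp: less_Suc_eq)
  then show ?case using Suc by auto
qed simp

lemma oriented_tangle_braid:
  "length v = 2 * n \<Longrightarrow> count_list v True = n \<Longrightarrow> oriented_tangle v (orientation_braid v) (standard n)"
proof (induction v rule: orientation_braid.induct)
  case (1 v)
  let ?p = "alt_len v"
  let ?P = "\<lambda>j. ?p < j \<and> j < length v \<and> v ! j \<noteq> v ! ?p"
  show ?case
  proof (cases "\<exists>j. ?P j")
    case True
    define j where "j = (LEAST j. ?P j)"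
    have j: "?P j" unfolding j_def using True by (rule LeastI_ex)
    have "count_list (move_entry ?p j v) True = n"
      using mset_move_entry[of ?p j v] j 1(3) by (simp add: count_mset[symmetric])
    then have "oriented_tangle (move_entry ?p j v) (orientation_braid (move_entry ?p j v)) (standard n)"
      using 1(1)[OF refl j_def True] 1(2) j length_move_entry[of ?p j v] by simp
    moreover have "orientation_braid v =
        map Cross_L (rev [?p..<j]) @ orientation_braid (move_entry ?p j v)"
      unfolding j_def using True
      by (subst orientation_braid.simps) (simp only: Let_def if_True)
    ultimately show ?thesis
      using oriented_tangle_append[OF oriented_tangle_move[of ?p j v]] j by simp
  next
    case False
    have p: "?p \<le> length v" and a: "\<forall>i<?p. v ! i = even i" using alt_len_prop[of v] by auto
    have "?p = length v"
    proof (rule ccontr)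
      assume "?p \<noteq> length v"
      then have lt: "?p < length v" using p by simp
      have ne: "v ! ?p \<noteq> even ?p" using alt_len_ge[of "Suc ?p" v] lt a by (auto simp: less_Suc_eq)
      have s: "v ! i = odd ?p" if "?p \<le> i" "i < length v" for i
        using False that ne by (cases "i = ?p") auto
      have c: "count_list v True = card {i. i < length v \<and> v ! i}"
        by (simp add: count_list_eq_length_filter length_filter_conv_card)
      show False
      proof (cases "even ?p")
        case True
        have "v ! i \<longleftrightarrow> i < ?p \<and> even i" if "i < length v" for i
          using a s[of i] True that by (cases "i < ?p") simp_all
        then have "{i. i < length v \<and> v ! i} = {i. i < ?p \<and> even i}"
          using p by auto
        then have "n = (?p + 1) div 2"
          using c 1(3) card_evens by simp
        then show False
          using True lt 1(2) by presburger
      next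
        case False
        have "v ! i \<longleftrightarrow> (i < ?p \<and> even i) \<or> ?p \<le> i" if "i < length v" for i
          using a s[of i] False that by (cases "i < ?p") simp_all
        then have "{i. i < length v \<and> v ! i} = {i. i < ?p \<and> even i} \<union> {?p..<length v}"
          using p by auto
        also have "card \<dots> = card {i. i < ?p \<and> even i} + card {?p..<length v}"
          by (rule card_Un_disjoint) auto
        finally have "n = (?p + 1) div 2 + (length v - ?p)"
          using c 1(3) card_evens by simp
        then show False
          using False lt 1(2) by presburger
      qed
    qed
    then have "v = standard n"
      using a 1(2) by (auto simp: standard_def intro!: nth_equalityI)
    moreover have "orientation_braid v = []"
      using False by (subst orientation_braid.simps) (simp only: Let_def if_False)
    ultimately show ?thesis by simp
  qed
qed

section \<open>Matchings and their drawings\<close>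

definition matchings :: "nat \<Rightarrow> nat set set set" where
  "matchings n = {m. partition_on {0..<2 * n} m \<and> (\<forall>e\<in>m. card e = 2)}"

text \<open>The bottom endpoints of the arc through a point.\<close>

definition arc_ends :: "diagram \<Rightarrow> point \<Rightarrow> nat set" where
  "arc_ends d p = {a. ((0, a), p) \<in> connected_by (all_arcs d)}"

text \<open>
  \<open>drawing n m d\<close>: the diagram \<open>d\<close> in the upper half plane consists of arcs that realise the
  matching \<open>m\<close> (and of no closed curves), all crossings being virtual; no arc crosses itself and
  two arcs cross at most once.
\<close>

definition virtual_at :: "diagram \<Rightarrow> nat \<Rightarrow> nat \<Rightarrow> bool" where
  "virtual_at d h i \<longleftrightarrow> h < length d \<and> d ! h = Virt i"

definition drawing :: "nat \<Rightarrow> nat set set \<Rightarrow> diagram \<Rightarrow> bool" where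
  "drawing n m d \<longleftrightarrow>
     tangle (2 * n) d 0 \<and>
     (\<forall>i. Cross_R i \<notin> set d \<and> Cross_L i \<notin> set d) \<and>
     (\<forall>p\<in>points (2 * n) d. arc_ends d p \<in> m) \<and>
     (\<forall>h i. virtual_at d h i \<longrightarrow> arc_ends d (h, i) \<noteq> arc_ends d (h, i + 1)) \<and>
     (\<forall>h i h' i'. virtual_at d h i \<and> virtual_at d h' i' \<and>
        {arc_ends d (h, i), arc_ends d (h, i + 1)} = {arc_ends d (h', i'), arc_ends d (h', i' + 1)}
        \<longrightarrow> h = h')"

section \<open>Modified closures\<close>

text \<open>
  The endpoint reached from the end \<open>p\<close> of the crossing at level \<open>h\<close> and position \<open>i\<close> by following
  the arc away from that crossing.
\<close>

definition leads_to :: "diagram \<Rightarrow> nat \<Rightarrow> nat \<Rightarrow> point \<Rightarrow> nat" where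
  "leads_to d h i p =
     (THE a. ((0, a), p) \<in>
        connected_by (all_arcs d - {((h, i), (h + 1, i + 1)), ((h, i + 1), (h + 1, i))}))"

text \<open>
  In the picture of the modification the ends leading to \<open>a\<^sub>1 < a\<^sub>2 < a\<^sub>3 < a\<^sub>4\<close> are at top right,
  bottom right, bottom left and top left; the original virtual crossing is on top and a classical
  crossing, with over-strand from bottom left to top right, is inserted below it.
\<close>

definition picture :: "nat \<Rightarrow> diagram" where
  "picture i = [Cross_R i, Virt i]"

text \<open>
  The ends occur clockwise in this picture.  In a drawing in the upper half plane, whose endpoints
  are \<open>0, \<dots>, 2n - 1\<close> from left to right, they occur counterclockwise.  So the two left ends of the
  picture have to be interchanged with the two right ends by further virtual crossings (a virtual
  detour, to which bracket and writhe are insensitive).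
  Now \<open>a\<^sub>1\<close> is at top left, \<open>a\<^sub>2\<close> at bottom left, \<open>a\<^sub>3\<close> at bottom right and \<open>a\<^sub>4\<close> at top right.
\<close>

definition modified :: "nat \<Rightarrow> diagram" where
  "modified i = [Virt i] @ picture i @ [Virt i]"

text \<open>A clockwise quarter turn of a diagram piece with two ends at the bottom and two at the top.\<close>

definition quarter_turn :: "(nat \<Rightarrow> diagram) \<Rightarrow> nat \<Rightarrow> diagram" where
  "quarter_turn g i = [Cup () i] @ g (i + 1) @ [Cap (i + 2)]"

text \<open>
  As the counterclockwise order of the ends is \<open>a\<^sub>1, a\<^sub>2, a\<^sub>3, a\<^sub>4\<close>, the position of the end leading
  to \<open>a\<^sub>1\<close> determines how the piece has to be turned.
\<close>

definition modified_crossing :: "diagram \<Rightarrow> nat \<Rightarrow> nat \<Rightarrow> diagram" where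
  "modified_crossing d h i =
     (let tl = leads_to d h i (h + 1, i); tr = leads_to d h i (h + 1, i + 1);
          br = leads_to d h i (h, i + 1); bl = leads_to d h i (h, i);
          a1 = Min {tl, tr, br, bl}
      in if tl = a1 then modified i
         else if tr = a1 then quarter_turn modified i
         else if br = a1 then quarter_turn (quarter_turn modified) i
         else quarter_turn (quarter_turn (quarter_turn modified)) i)"

definition modify :: "diagram \<Rightarrow> diagram" where
  "modify d = concat (map (\<lambda>h. case d ! h of Virt i \<Rightarrow> modified_crossing d h i | x \<Rightarrow> [x])
     [0..<length d])"

text \<open>
  The exterior part of a modified closure with a choice of orientation that is compatible with
  the standard orientation of the tangle it is attached to.  Such a choice always exists (see
  below); it is unique except for components that do not meet the tangle.
\<close>

definition oriented_exterior :: "nat \<Rightarrow> diagram \<Rightarrow> oriented_diagram \<Rightarrow> bool" where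
  "oriented_exterior n d E \<longleftrightarrow> oriented_tangle (standard n) E [] \<and> forget E = modify d"

text \<open>
  An orientation in which the directions alternate at every level between the modified crossings.
\<close>

fun label_letter :: "unit letter \<Rightarrow> bool letter" where
  "label_letter (Cup _ i) = Cup (even i) i"
| "label_letter (Cap i) = Cap i"
| "label_letter (Virt i) = Virt i"
| "label_letter (Cross_R i) = Cross_R i"
| "label_letter (Cross_L i) = Cross_L i"

abbreviation alt :: "nat \<Rightarrow> bool list" where
  "alt k \<equiv> map even [0..<k]"

lemma forget_label: "forget (map label_letter w) = w"
proof -
  have "map_letter (\<lambda>_. ()) (label_letter x) = x" for x by (cases x) auto
  then show ?thesis by (induction w) (auto simp: forget_def)
qed

lemma alt_Cup: "i \<le> k \<Longrightarrow> orient_after (Cup (even i) i) (alt k) = alt (k + 2)"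
proof (rule nth_equalityI, goal_cases)
  case (2 j)
  consider "j < i" | "j = i" | "j = i + 1" | "i + 2 \<le> j" by linarith
  then show ?case using 2
    by cases (auto simp: nth_append nth_Cons' min_def simp del: upt_Suc)
qed auto

lemma alt_Cap: "i + 1 < k \<Longrightarrow> orient_after (Cap i) (alt k) = alt (k - 2)"
  by (rule nth_equalityI) (auto simp: nth_append min_def)

lemma alt_modified:
  "i + 1 < k \<Longrightarrow> oriented_tangle (alt k) (map label_letter (modified i)) (alt k)"
  unfolding modified_def picture_def
  by (auto simp: list_eq_iff_nth_eq nth_list_update)

lemma alt_turn:
  assumes "\<And>i k. i + 1 < k \<Longrightarrow> oriented_tangle (alt k) (map label_letter (g i)) (alt k)" "i + 1 < k"
  shows "oriented_tangle (alt k) (map label_letter (quarter_turn g i)) (alt k)"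
proof -
  have "oriented_tangle (alt (k + 2)) (map label_letter (g (i + 1)) @ [Cap (i + 2)]) (alt k)"
    using assms alt_Cap[of "i + 2" "k + 2"]
    by (intro oriented_tangle_append[OF assms(1)]) (auto simp del: upt_Suc)
  then show ?thesis using alt_Cup[of i k] assms(2)
    by (auto simp: quarter_turn_def simp del: orient_after.simps upt_Suc)
qed

lemma alt_modified_crossing:
  "i + 1 < k \<Longrightarrow> oriented_tangle (alt k) (map label_letter (modified_crossing d h i)) (alt k)"
  unfolding modified_crossing_def Let_def
  by (simp only: if_distrib[of "map label_letter"] split: if_split)
     (blast intro: alt_modified alt_turn)

lemma alt_exterior:
  assumes "tangle k d l" "\<And>i. Cross_R i \<notin> set d \<and> Cross_L i \<notin> set d"
    and "\<And>h i k. i + 1 < k \<Longrightarrow> oriented_tangle (alt k) (map label_letter (M h i)) (alt k)"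
  shows "oriented_tangle (alt k) (map label_letter
    (concat (map (\<lambda>h. case d ! h of Virt i \<Rightarrow> M h i | x \<Rightarrow> [x]) [0..<length d]))) (alt l)"
  using assms
proof (induction d arbitrary: k M)
  case (Cons x d)
  let ?g = "\<lambda>M d h. case d ! h of Virt i \<Rightarrow> M h i | x \<Rightarrow> [x]"
  let ?M = "\<lambda>h. M (Suc h)"
  have e: "map (?g M (x # d)) [0..<length (x # d)] = ?g M (x # d) 0 # map (?g ?M d) [0..<length d]"
    by (simp add: upt_conv_Cons map_Suc_upt[symmetric] o_def del: upt_Suc)
  have IH: "oriented_tangle (alt (width_after x k))
      (map label_letter (concat (map (?g ?M d) [0..<length d]))) (alt l)"
    using Cons.prems by (intro Cons.IH) auto
  have 1: "oriented_tangle (alt k) (map label_letter (?g M (x # d) 0)) (alt (width_after x k))"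
    using Cons.prems alt_Cup alt_Cap
    by (cases x) (auto simp del: orient_after.simps upt_Suc)
  show ?case
    unfolding e using oriented_tangle_append[OF 1 IH] by simp
qed simp

lemma oriented_exterior_exists:
  assumes "drawing n m d"
  shows "\<exists>E. oriented_exterior n d E"
proof (intro exI)
  have "oriented_tangle (alt (2 * n)) (map label_letter (modify d)) (alt 0)"
    using assms unfolding modify_def drawing_def
    by (intro alt_exterior alt_modified_crossing) auto
  then show "oriented_exterior n d (map label_letter (modify d))"
    by (simp add: oriented_exterior_def standard_def forget_label)
qed

text \<open>
  The closure \<open>T\<^sup>B(m)\<close>, modified in its exterior part and oriented, as a link diagram.
\<close>

definition modified_closure ::
    "oriented_diagram \<Rightarrow> bool list \<Rightarrow> oriented_diagram \<Rightarrow> oriented_diagram" where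
  "modified_closure T v E = T @ orientation_braid v @ E"

end

theory Submission
  imports Defs
begin

text \<open>
  Smoothing the classical crossings of \<open>T'\<close> writes the bracket of \<open>T \<union> T'\<close> as a combination of
  brackets of virtual closures of \<open>T\<close>.  The bracket of a virtual closure depends only on the matching
  that the exterior induces on the endpoints, up to a power of the loop value.  Smoothing the inserted
  crossings of a modified closure of \<open>m\<close> with \<open>N\<close> crossings yields \<open>A\<^sup>N\<close> times the
  closure by \<open>m\<close> plus closures with fewer than \<open>N\<close> virtual crossings.  A drawing has exactly as many
  crossings as its matching has interlaced pairs of arcs, and any diagram realising a matching has at
  least that many; so the transition matrix is triangular with units on the diagonal, and modified
  closures span as well.  The orientation braid is invertible by the second Reidemeister move, hence it
  does not affect spanning, and the writhes of \<open>T \<union> T'\<close> and of the closures differ from that of \<open>T\<close>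
  by amounts that do not depend on \<open>T\<close>.
\<close>

section \<open>Gluing diagrams along strand labels\<close>

text \<open>The coefficients must be found before \<open>T\<close> is known, so the facts about
  exteriors are stated for all lower words \<open>u\<close> at once, classical crossings in
  \<open>u\<close> included. An exterior without classical crossings is reduced to combinatorial
  data: a list of labels at its bottom, equal labels marking the two ends of an arc, and a number of
  closed curves. The data are computed from the top letter downwards; a local minimum is the only
  letter that can join labels or close a curve. They determine the component count of every gluing.
  The exponent \<open>num_components - 1\<close> of the loop value is a truncated subtraction, so
  closed curves of the exterior can be pulled out as factors only if a component meeting the
  interface remains; this is where \<open>n \<ge> 1\<close> enters. The bounds on crossing numbers
  come from parity and not from moves on diagrams: a virtual crossing of two given arcs is the only
  event that changes the parity of their inversions, so in every diagram with the given ends two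
  arcs cross an odd number of times exactly if they are interlaced. This one fact yields both the
  upper bound for drawings and the lower bound for arbitrary exteriors.\<close>

definition lift_point :: "nat \<Rightarrow> point \<Rightarrow> point" where
  "lift_point m p = (m + fst p, snd p)"

lemma lift_point_simps [simp]: "lift_point m (h, j) = (m + h, j)"
  by (simp add: lift_point_def)

lemma lift_point_eq_iff [simp]: "lift_point m p = lift_point m q \<longleftrightarrow> p = q"
  by (cases p; cases q) auto

abbreviation lift_arcs :: "nat \<Rightarrow> (point \<times> point) set \<Rightarrow> (point \<times> point) set" where
  "lift_arcs m R \<equiv> map_prod (lift_point m) (lift_point m) ` R"

lemma arcs_add: "arcs (m + h) x = lift_arcs m (arcs h x)"
  by (cases x) (simp_all add: image_Un setcompr_eq_image image_image)

lemma all_arcs_append: "all_arcs (u @ w) = all_arcs u \<union> lift_arcs (length u) (all_arcs w)"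
proof -
  have "{..<length (u @ w)} = {..<length u} \<union> (\<lambda>h. length u + h) ` {..<length w}"
  proof (intro equalityI subsetI)
    fix h assume "h \<in> {..<length (u @ w)}"
    then show "h \<in> {..<length u} \<union> (\<lambda>h. length u + h) ` {..<length w}"
      by (cases "h < length u") (auto intro!: image_eqI[of _ _ "h - length u"])
  qed auto
  then have "all_arcs (u @ w) = (\<Union>h<length u. arcs h (u ! h)) \<union>
      (\<Union>h<length w. arcs (length u + h) (w ! h))"
    unfolding all_arcs_def by (simp add: nth_append)
  then show ?thesis
    by (simp add: all_arcs_def arcs_add image_UN)
qed

lemma all_arcs_Nil [simp]: "all_arcs [] = {}"
  by (simp add: all_arcs_def)

lemma all_arcs_Cons: "all_arcs (x # w) = arcs 0 x \<union> lift_arcs 1 (all_arcs w)"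
proof -
  have "all_arcs [x] = arcs 0 x" by (simp add: all_arcs_def lessThan_Suc)
  then show ?thesis using all_arcs_append[of "[x]" w] by simp
qed

lemma tangle_append: "tangle k (u @ w) l \<longleftrightarrow> (\<exists>r. tangle k u r \<and> tangle r w l)"
  by (induction u arbitrary: k) auto

lemma fold_width_after: "tangle k w l \<Longrightarrow> fold width_after w k = l"
  by (induction w arbitrary: k) auto

lemma points_append:
  assumes "tangle k u r"
  shows "points k (u @ w) = points k u \<union> lift_point (length u) ` points r w"
proof (intro equalityI subsetI)
  fix p assume p: "p \<in> points k (u @ w)"
  obtain h j where hj: "p = (h, j)" by force
  show "p \<in> points k u \<union> lift_point (length u) ` points r w"
  proof (cases "h \<le> length u")
    case True
    then show ?thesis using p by (simp add: points_def hj)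
  next
    case False
    then have "(h - length u, j) \<in> points r w"
      using p fold_width_after[OF assms] by (auto simp: points_def hj)
    then have "lift_point (length u) (h - length u, j) \<in> lift_point (length u) ` points r w"
      by (rule imageI)
    then show ?thesis using False by (simp add: hj)
  qed
next
  fix p assume "p \<in> points k u \<union> lift_point (length u) ` points r w"
  then show "p \<in> points k (u @ w)"
    using fold_width_after[OF assms] by (auto simp: points_def)
qed

lemma finite_points: "finite (points k w)"
proof (rule finite_subset)
  show "points k w \<subseteq> (SIGMA h:{..length w}. {..<fold width_after (take h w) k})"
    by (auto simp: points_def)
qed auto

lemma bottom_in_points [simp]: "(0, j) \<in> points k w \<longleftrightarrow> j < k"
  by (simp add: points_def)

lemma top_in_points: "tangle k w l \<Longrightarrow> (length w, j) \<in> points k w \<longleftrightarrow> j < l"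
  by (simp add: points_def fold_width_after)

text \<open>\<open>arcs\<close> leaves positions unbounded, so a chain of arcs might wander through
  strands that the diagram does not have. Closure of the genuine points under arcs in both
  directions confines every chain that starts at one of them.\<close>

lemma arcs_points_iff:
  "tangle k w l \<Longrightarrow> (p, q) \<in> all_arcs w \<Longrightarrow> p \<in> points k w \<longleftrightarrow> q \<in> points k w"
proof (induction w arbitrary: k p q)
  case Nil
  then show ?case by (simp add: all_arcs_def)
next
  case (Cons x w)
  let ?k = "width_after x k"
  have t: "tangle k [x] ?k" using Cons.prems(1) by simp
  have points: "points k (x # w) = points k [x] \<union> lift_point 1 ` points ?k w"
    using points_append[OF t, of w] by simp
  have low: "(0, j) \<in> points k (x # w) \<longleftrightarrow> j < k"
      "(Suc 0, j) \<in> points k (y # w) \<longleftrightarrow> j < width_after y k" for j and y :: "'a letter"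
    by (simp_all add: points_def)
  have high: "lift_point 1 r \<in> points k (x # w) \<longleftrightarrow> r \<in> points ?k w" for r
    by (cases r) (simp add: points_def)
  have "(p, q) \<in> arcs 0 x \<union> lift_arcs 1 (all_arcs w)"
    using Cons.prems(2) by (simp add: all_arcs_Cons)
  then show ?case
  proof
    assume "(p, q) \<in> arcs 0 x"
    then show ?thesis using Cons.prems(1)
      by (cases x) (auto simp: low)
  next
    assume "(p, q) \<in> lift_arcs 1 (all_arcs w)"
    then obtain p' q' where "p = lift_point 1 p'" "q = lift_point 1 q'" "(p', q') \<in> all_arcs w"
      by auto
    then show ?thesis using Cons.IH[of ?k p' q'] Cons.prems(1) high by auto
  qed
qed

section \<open>Connectedness and labellings of components\<close>

lemma connected_by_refl [simp, intro]: "(p, p) \<in> connected_by R"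
  by (simp add: connected_by_def)

lemma connected_by_sym: "(p, q) \<in> connected_by R \<Longrightarrow> (q, p) \<in> connected_by R"
  unfolding connected_by_def by (rule symD[OF sym_rtrancl]) (auto simp: sym_def)

lemma connected_by_trans:
  "(p, q) \<in> connected_by R \<Longrightarrow> (q, r) \<in> connected_by R \<Longrightarrow> (p, r) \<in> connected_by R"
  unfolding connected_by_def by (rule rtrancl_trans)

lemma connected_by_arc: "(p, q) \<in> R \<Longrightarrow> (p, q) \<in> connected_by R"
  by (auto simp: connected_by_def)

lemma equiv_connected_by: "equiv UNIV (connected_by R)"
  by (rule equivI)
    (auto simp: refl_on_def intro: symI transI connected_by_sym connected_by_trans)

lemma connected_by_mono:
  assumes "(p, q) \<in> connected_by R" "\<And>p q. (p, q) \<in> R \<Longrightarrow> (f p, f q) \<in> connected_by S"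
  shows "(f p, f q) \<in> connected_by S"
  using assms(1) unfolding connected_by_def[of R]
proof (induction rule: rtrancl_induct)
  case (step y z)
  then have "(f y, f z) \<in> connected_by S"
    using assms(2) connected_by_sym by blast
  then show ?case using step.IH connected_by_trans by blast
qed simp

lemma connected_by_invariant:
  assumes "(p, q) \<in> connected_by R" "p \<in> X"
    and "\<And>p q. (p, q) \<in> R \<Longrightarrow> p \<in> X \<longleftrightarrow> q \<in> X"
    and "\<And>p q. (p, q) \<in> R \<Longrightarrow> p \<in> X \<Longrightarrow> q \<in> X \<Longrightarrow> L p = L q"
  shows "q \<in> X \<and> L p = L q"
  using assms(1) unfolding connected_by_def
proof (induction rule: rtrancl_induct)
  case base
  then show ?case using assms(2) by simp
next
  case (step y z)
  then show ?case using assms(3,4)[of y z] assms(3,4)[of z y] by auto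
qed

lemma connected_by_lift:
  assumes "(p, q) \<in> connected_by R" "lift_arcs m R \<subseteq> S"
  shows "(lift_point m p, lift_point m q) \<in> connected_by S"
  using assms(1) by (rule connected_by_mono) (use assms(2) in \<open>auto intro!: connected_by_arc\<close>)

text \<open>A complete invariant of components, so that counting label values replaces counting
  classes. Constancy is asked on single arcs only; it extends to connected points because no arc
  leaves the diagram.\<close>

definition labelling :: "nat \<Rightarrow> 'a letter list \<Rightarrow> (point \<Rightarrow> 'b) \<Rightarrow> bool" where
  "labelling k w L \<longleftrightarrow>
     (\<forall>p\<in>points k w. \<forall>q\<in>points k w. (p, q) \<in> all_arcs w \<longrightarrow> L p = L q) \<and>
     (\<forall>p\<in>points k w. \<forall>q\<in>points k w. L p = L q \<longrightarrow> (p, q) \<in> connected_by (all_arcs w))"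

lemma labelling_connected:
  assumes "labelling k w L" "tangle k w l" "(p, q) \<in> connected_by (all_arcs w)" "p \<in> points k w"
  shows "q \<in> points k w \<and> L p = L q"
proof (rule connected_by_invariant[OF assms(3,4)])
  show "p \<in> points k w \<longleftrightarrow> q \<in> points k w" if "(p, q) \<in> all_arcs w" for p q
    using arcs_points_iff[OF assms(2) that] .
  show "L p = L q" if "(p, q) \<in> all_arcs w" "p \<in> points k w" "q \<in> points k w" for p q
    using assms(1) that unfolding labelling_def by blast
qed

lemma labelling_iff:
  assumes "labelling k w L" "tangle k w l" "p \<in> points k w" "q \<in> points k w"
  shows "L p = L q \<longleftrightarrow> (p, q) \<in> connected_by (all_arcs w)"
  using assms labelling_connected[OF assms(1,2)] unfolding labelling_def by blast

text \<open>The number of values of a map depends only on its kernel. This trades equivalence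
  classes for labels in the component count.\<close>

lemma card_image_eq_kernel:
  assumes "\<And>x y. x \<in> A \<Longrightarrow> y \<in> A \<Longrightarrow> f x = f y \<longleftrightarrow> g x = g y"
  shows "card (f ` A) = card (g ` A)"
proof -
  let ?h = "\<lambda>c. g (inv_into A f c)"
  have inv: "inv_into A f (f x) \<in> A" "f (inv_into A f (f x)) = f x" if "x \<in> A" for x
    using that by (simp_all add: inv_into_into f_inv_into_f)
  have h: "?h (f x) = g x" if "x \<in> A" for x
    using assms[OF inv(1)[OF that] that] inv(2)[OF that] by simp
  have "inj_on ?h (f ` A)"
    by (rule inj_onI) (use h assms in force)
  then have "card (?h ` f ` A) = card (f ` A)" by (rule card_image)
  moreover have "?h ` f ` A = g ` A"
    unfolding image_image using h by (rule image_cong[OF refl])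
  ultimately show ?thesis by simp
qed

lemma card_components:
  assumes "labelling k w L" "tangle k w l"
  shows "card (points k w // connected_by (all_arcs w)) = card (L ` points k w)"
proof -
  let ?C = "connected_by (all_arcs w)"
  have "points k w // ?C = (\<lambda>p. ?C `` {p}) ` points k w"
    by (auto simp: quotient_def)
  moreover have "?C `` {p} = ?C `` {q} \<longleftrightarrow> L p = L q" if "p \<in> points k w" "q \<in> points k w" for p q
    using labelling_iff[OF assms that] eq_equiv_class_iff[OF equiv_connected_by UNIV_I UNIV_I]
    by blast
  ultimately show ?thesis
    using card_image_eq_kernel[of "points k w" "\<lambda>p. ?C `` {p}" L] by simp
qed

text \<open>
  \<open>denotes w as c\<close>: the strands of \<open>w\<close> match up the bottom endpoints with equal entries of \<open>as\<close>, and
  \<open>w\<close> has \<open>c\<close> closed curves; these carry the labels \<open>Inr\<close>.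
\<close>

definition denoted_by :: "(point \<Rightarrow> nat + nat) \<Rightarrow> 'a letter list \<Rightarrow> nat list \<Rightarrow> nat \<Rightarrow> bool" where
  "denoted_by L w as c \<longleftrightarrow> labelling (length as) w L \<and>
     (\<forall>j<length as. L (0, j) = Inl (as ! j)) \<and>
     (\<forall>p\<in>points (length as) w. \<forall>a. L p = Inl a \<longrightarrow> a \<in> set as) \<and>
     c = card (L ` points (length as) w \<inter> range Inr)"

definition denotes :: "'a letter list \<Rightarrow> nat list \<Rightarrow> nat \<Rightarrow> bool" where
  "denotes w as c \<longleftrightarrow> tangle (length as) w 0 \<and> (\<forall>a\<in>set as. count_list as a = 2) \<and>
     (\<exists>L. denoted_by L w as c)"

lemma denotes_tangle: "denotes w as c \<Longrightarrow> tangle (length as) w 0"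
  by (simp add: denotes_def)

lemma denotes_count: "denotes w as c \<Longrightarrow> a \<in> set as \<Longrightarrow> count_list as a = 2"
  by (simp add: denotes_def)

lemma denotes_Nil: "denotes [] [] 0"
  by (simp add: denotes_def denoted_by_def labelling_def points_def)

text \<open>Labels for a diagram with one more letter at the bottom: \<open>g\<close> names the new
  bottom points, and \<open>f\<close> renames the old labels, so that a local minimum can merge two
  arcs above it or turn one into a closed curve.\<close>

fun extend_labelling :: "('b \<Rightarrow> 'c) \<Rightarrow> (nat \<Rightarrow> 'c) \<Rightarrow> (point \<Rightarrow> 'b) \<Rightarrow> point \<Rightarrow> 'c" where
  "extend_labelling f g L (0, j) = g j"
| "extend_labelling f g L (Suc h, j) = f (L (h, j))"

lemma extend_labelling_lift [simp]: "extend_labelling f g L (lift_point (Suc 0) p) = f (L p)"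
  by (cases p) simp

lemma points_Cons:
  "points k (x # w) = (\<lambda>j. (0, j)) ` {..<k} \<union> lift_point 1 ` points (width_after x k) w"
proof (intro equalityI subsetI)
  fix p assume p: "p \<in> points k (x # w)"
  obtain h j where hj: "p = (h, j)" by force
  show "p \<in> (\<lambda>j. (0, j)) ` {..<k} \<union> lift_point 1 ` points (width_after x k) w"
  proof (cases h)
    case 0
    then show ?thesis using p by (simp add: hj)
  next
    case (Suc h')
    then have "(h', j) \<in> points (width_after x k) w" using p by (simp add: points_def hj)
    then have "lift_point 1 (h', j) \<in> lift_point 1 ` points (width_after x k) w" by (rule imageI)
    then show ?thesis by (simp add: hj Suc)
  qed
qed (auto simp: points_def)

lemma lift_in_points [simp]:
  "lift_point (Suc 0) p \<in> points k (x # w) \<longleftrightarrow> p \<in> points (width_after x k) w"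
  by (cases p) (simp add: points_def)

text \<open>Questions of connectedness are pushed up into \<open>w\<close>, where
  \<open>merge\<close> answers them. This fails only for bottom points without an arc leading up,
  the two ends of a local maximum, and for these \<open>low\<close> allows a direct
  argument.\<close>

lemma labelling_Cons:
  fixes w :: "'a letter list" and x :: "'a letter"
  assumes x: "admissible k x" and t: "tangle (width_after x k) w l"
    and L: "labelling (width_after x k) w L"
    and arc: "\<And>j p. j < k \<Longrightarrow> ((0, j), p) \<in> arcs 0 x \<Longrightarrow>
      extend_labelling f g L (0, j) = extend_labelling f g L p"
    and arc1: "\<And>i j. ((Suc 0, i), (Suc 0, j)) \<in> arcs 0 x \<Longrightarrow> i < width_after x k \<Longrightarrow> j < width_after x k \<Longrightarrow>
      f (L (0, i)) = f (L (0, j))"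
    and merge: "\<And>p q. p \<in> points (width_after x k) w \<Longrightarrow> q \<in> points (width_after x k) w \<Longrightarrow>
      f (L p) = f (L q) \<Longrightarrow>
      (lift_point 1 p, lift_point 1 q) \<in> connected_by (all_arcs (x # w))"
    and low: "\<And>j. j < k \<Longrightarrow>
      (\<exists>j'<width_after x k. ((0, j), (1, j')) \<in> arcs 0 x) \<or>
      (\<forall>q\<in>points k (x # w). g j = extend_labelling f g L q \<longrightarrow>
        ((0, j), q) \<in> connected_by (all_arcs (x # w)))"
  shows "labelling k (x # w) (extend_labelling f g L)"
proof -
  let ?L = "extend_labelling f g L" and ?k = "width_after x k"
  let ?C = "connected_by (all_arcs (x # w))"
  have tx: "tangle k (x # w) l" using x t by simp
  have arcs: "?L p = ?L q" if pq: "p \<in> points k (x # w)" "q \<in> points k (x # w)"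
    "(p, q) \<in> all_arcs (x # w)" for p q
  proof -
    consider "(p, q) \<in> arcs 0 x" | "(p, q) \<in> lift_arcs 1 (all_arcs w)"
      using pq(3) by (auto simp: all_arcs_Cons)
    then show ?thesis
    proof cases
      case 1
      then consider j where "p = (0, j)" | i j where "p = (Suc 0, i)" "q = (Suc 0, j)"
        by (cases x) auto
      then show ?thesis
      proof cases
        case (1 j)
        then show ?thesis using arc[of j q] pq(1) \<open>(p, q) \<in> arcs 0 x\<close> by simp
      next
        case (2 i j)
        then have "i < ?k" "j < ?k" using pq by (simp_all add: points_def)
        then show ?thesis using arc1[of i j] \<open>(p, q) \<in> arcs 0 x\<close> 2 by simp
      qed
    next
      case 2
      then obtain p' q' where *: "p = lift_point 1 p'" "q = lift_point 1 q'" "(p', q') \<in> all_arcs w"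
        by auto
      have "p' \<in> points ?k w" "q' \<in> points ?k w"
        using pq(1,2) * by simp_all
      then show ?thesis using * L unfolding labelling_def by (metis One_nat_def extend_labelling_lift)
    qed
  qed
  have invariant: "?L p = ?L q" if "p \<in> points k (x # w)" "(p, q) \<in> ?C" for p q
    using connected_by_invariant[OF that(2,1) arcs_points_iff[OF tx], of ?L] arcs by blast
  have "(p, q) \<in> ?C" if pq: "p \<in> points k (x # w)" "q \<in> points k (x # w)" "?L p = ?L q" for p q
  proof -
    let ?good = "\<lambda>p. \<exists>p'\<in>points ?k w. (p, lift_point 1 p') \<in> ?C"
    have bad: "(\<forall>q\<in>points k (x # w). ?L p = ?L q \<longrightarrow> (p, q) \<in> ?C)"
      if p: "p \<in> points k (x # w)" "\<not> ?good p" for p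
    proof -
      have "p \<notin> lift_point 1 ` points ?k w" using p(2) by auto
      then obtain j where j: "p = (0, j)" "j < k" using p(1) by (auto simp: points_Cons)
      have "\<not> (\<exists>j'<?k. ((0, j), (1, j')) \<in> arcs 0 x)"
      proof
        assume "\<exists>j'<?k. ((0, j), (1, j')) \<in> arcs 0 x"
        then obtain j' where "j' < ?k" "((0, j), (1, j')) \<in> arcs 0 x" by blast
        then have "(0, j') \<in> points ?k w" "(p, lift_point 1 (0, j')) \<in> ?C"
          using j by (auto intro!: connected_by_arc simp: all_arcs_Cons)
        then show False using p(2) by blast
      qed
      then have "\<forall>q\<in>points k (x # w). g j = ?L q \<longrightarrow> ((0, j), q) \<in> ?C"
        using low[OF j(2)] by blast
      then show ?thesis using j(1) by simp
    qed
    show ?thesis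
    proof (cases "?good p \<and> ?good q")
      case True
      then obtain p' q' where *: "p' \<in> points ?k w" "(p, lift_point 1 p') \<in> ?C"
        "q' \<in> points ?k w" "(q, lift_point 1 q') \<in> ?C" by blast
      then have "f (L p') = f (L q')"
        using invariant[OF pq(1) *(2)] invariant[OF pq(2) *(4)] pq(3) by simp
      then show ?thesis
        using merge[OF *(1,3)] * connected_by_sym connected_by_trans by metis
    next
      case False
      then show ?thesis using bad[of p] bad[of q] pq connected_by_sym by metis
    qed
  qed
  then show ?thesis using arcs unfolding labelling_def by blast
qed

lemma connected_by_Cons_lift:
  "(p, q) \<in> connected_by (all_arcs w) \<Longrightarrow>
    (lift_point 1 p, lift_point 1 q) \<in> connected_by (all_arcs (x # w))"
  by (erule connected_by_lift) (unfold all_arcs_Cons, rule Un_upper2)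

lemma labelled_connected:
  "labelling k w L \<Longrightarrow> p \<in> points k w \<Longrightarrow> q \<in> points k w \<Longrightarrow> L p = L q \<Longrightarrow>
    (p, q) \<in> connected_by (all_arcs w)"
  unfolding labelling_def by blast

lemma denoted_byD:
  assumes "denoted_by L w as c"
  shows "labelling (length as) w L"
    and "\<And>j. j < length as \<Longrightarrow> L (0, j) = Inl (as ! j)"
    and "\<And>p a. p \<in> points (length as) w \<Longrightarrow> L p = Inl a \<Longrightarrow> a \<in> set as"
    and "c = card (L ` points (length as) w \<inter> range Inr)"
  using assms by (simp_all add: denoted_by_def)

lemma denotes_ConsI:
  fixes f :: "nat + nat \<Rightarrow> nat + nat"
  assumes lab: "labelling (length as) (x # w) (extend_labelling f (\<lambda>j. Inl (as ! j)) L)"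
    and t: "tangle (length as) (x # w) 0" and count: "\<And>a. a \<in> set as \<Longrightarrow> count_list as a = 2"
    and k: "width_after x (length as) = k"
    and set: "\<And>p a. p \<in> points k w \<Longrightarrow> f (L p) = Inl a \<Longrightarrow> a \<in> set as"
    and card: "c = card ((\<lambda>p. f (L p)) ` points k w \<inter> range Inr)"
  shows "denotes (x # w) as c"
proof -
  let ?L = "extend_labelling f (\<lambda>j. Inl (as ! j)) L"
  have img: "?L ` points (length as) (x # w) =
      (\<lambda>j. Inl (as ! j)) ` {..<length as} \<union> (\<lambda>p. f (L p)) ` points k w"
    using k by (simp add: points_Cons image_Un image_image)
  have "?L ` points (length as) (x # w) \<inter> range Inr = (\<lambda>p. f (L p)) ` points k w \<inter> range Inr"
    unfolding img by auto
  moreover have "a \<in> set as" if "p \<in> points (length as) (x # w)" "?L p = Inl a" for p a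
    using that set k by (auto simp: points_Cons)
  ultimately show ?thesis
    unfolding denotes_def denoted_by_def using lab t count card by (intro conjI exI[of _ ?L]) auto
qed

lemma denotes_Virt:
  assumes "denotes w (ys @ [a, b] @ zs) c" "i = length ys"
  shows "denotes (Virt i # w) (ys @ [b, a] @ zs) c"
proof -
  let ?as = "ys @ [a, b] @ zs" and ?bs = "ys @ [b, a] @ zs"
  obtain L where "denoted_by L w ?as c"
    using assms(1) unfolding denotes_def by blast
  note L = denoted_byD[OF this]
  have k: "width_after (Virt i) (length ?bs) = length ?as" by simp
  have t: "tangle (length ?as) w 0" using assms(1) by (rule denotes_tangle)
  have L0: "L (0, j) = Inl (?as ! j)" if "j < length ?bs" for j using L(2) that by simp
  show ?thesis
  proof (rule denotes_ConsI)
    show "labelling (length ?bs) (Virt i # w) (extend_labelling id (\<lambda>j. Inl (?bs ! j)) L)"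
    proof (rule labelling_Cons[where l = 0], goal_cases)
      case 1 then show ?case using assms(2) by simp
    next
      case 2 then show ?case unfolding k by (rule t)
    next
      case 3 then show ?case unfolding k by (rule L(1))
    next
      case (4 j p)
      then show ?case using assms(2) by (auto simp: L0 nth_append)
    next
      case 5 then show ?case by simp
    next
      case (6 p q)
      then have "(p, q) \<in> connected_by (all_arcs w)"
        unfolding k by (intro labelled_connected[OF L(1)]) simp_all
      then show ?case by (rule connected_by_Cons_lift)
    next
      case (7 j)
      let ?j = "if j = i then i + 1 else if j = i + 1 then i else j"
      have "?j < length ?as \<and> ((0, j), (1, ?j)) \<in> arcs 0 (Virt i)"
        using 7 assms(2) by simp
      then show ?case unfolding k by blast
    qed
    show "tangle (length ?bs) (Virt i # w) 0" using t assms(2) by simp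
    show "count_list ?bs x = 2" if "x \<in> set ?bs" for x
      using denotes_count[OF assms(1), of x] that by (cases "x = a"; cases "x = b") auto
    show "x \<in> set ?bs" if "p \<in> points (length ?as) w" "id (L p) = Inl x" for p x
      using L(3)[of p x] that by auto
  qed (use k L(4) in auto)
qed

lemma denotes_Cap:
  assumes "denotes w (ys @ zs) c" "i = length ys" "a \<notin> set (ys @ zs)"
  shows "denotes (Cap i # w) (ys @ [a, a] @ zs) c"
proof -
  let ?as = "ys @ zs" and ?bs = "ys @ [a, a] @ zs"
  obtain L where "denoted_by L w ?as c"
    using assms(1) unfolding denotes_def by blast
  note L = denoted_byD[OF this]
  have k: "width_after (Cap i) (length ?bs) = length ?as" by simp
  have t: "tangle (length ?as) w 0" using assms(1) by (rule denotes_tangle)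
  let ?L = "extend_labelling id (\<lambda>j. Inl (?bs ! j)) L"
  have arc: "((0, i), (0, i + 1)) \<in> connected_by (all_arcs (Cap i # w))"
    by (rule connected_by_arc) (simp add: all_arcs_Cons)
  show ?thesis
  proof (rule denotes_ConsI)
    show "labelling (length ?bs) (Cap i # w) ?L"
    proof (rule labelling_Cons[where l = 0], goal_cases)
      case 1 then show ?case using assms(2) by simp
    next
      case 2 then show ?case unfolding k by (rule t)
    next
      case 3 then show ?case unfolding k by (rule L(1))
    next
      case (4 j p)
      then consider "j = i" "p = (0, i + 1)" | "j < i" "p = (1, j)"
        | j' where "j = j' + 2" "i \<le> j'" "p = (1, j')" by auto
      then show ?case using 4(1) assms(2) L(2)
        by cases (auto simp: nth_append nth_Cons')
    next
      case 5 then show ?case by simp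
    next
      case (6 p q)
      then have "(p, q) \<in> connected_by (all_arcs w)"
        unfolding k by (intro labelled_connected[OF L(1)]) simp_all
      then show ?case by (rule connected_by_Cons_lift)
    next
      case (7 j)
      consider "j < i" | "j = i \<or> j = i + 1" | "i + 2 \<le> j" by linarith
      then show ?case
      proof cases
        case 1
        then show ?thesis using assms(2) by (intro disjI1 exI[of _ j]) auto
      next
        case 3
        then have "((0, j - 2 + 2), (1, j - 2)) \<in> arcs 0 (Cap i)" by simp
        then show ?thesis using assms(2) 7 3 by (intro disjI1 exI[of _ "j - 2"]) auto
      next
        case 2
        \<comment> \<open>Freshness of \<open>a\<close> leaves the two ends of the local maximum as
          its only carriers, and these are joined by an arc of the letter itself.\<close>
        have "q = (0, i) \<or> q = (0, i + 1)"
          if q: "q \<in> points (length ?bs) (Cap i # w)" "?L q = Inl a" for q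
        proof -
          consider j' where "q = (0, j')" "j' < length ?bs"
            | p where "q = lift_point 1 p" "p \<in> points (length ?as) w"
            using q(1) unfolding points_Cons k by auto
          then show ?thesis
          proof cases
            case (1 j')
            have "j' = length ys \<or> j' = length ys + 1"
            proof (rule ccontr)
              assume *: "\<not> ?thesis"
              have "?bs ! j' \<in> set (ys @ zs)"
              proof (cases "j' < length ys")
                case False
                then have "?bs ! j' = zs ! (j' - length ys - 2)" "j' - length ys - 2 < length zs"
                  using * 1 by (auto simp: nth_append nth_Cons')
                then show ?thesis by simp
              qed (simp add: nth_append)
              then show False using q(2) 1 assms(3) by simp
            qed
            then show ?thesis using 1 assms(2) by simp
          next
            case (2 p)
            then show ?thesis using q(2) L(3)[of p a] assms(3) by simp
          qed
        qed
        moreover have "?bs ! j = a" using 2 assms(2) by (auto simp: nth_append)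
        ultimately show ?thesis
          using 2 arc connected_by_sym[OF arc] by fastforce
      qed
    qed
    show "tangle (length ?bs) (Cap i # w) 0" using t assms(2) by simp
    show "count_list ?bs x = 2" if "x \<in> set ?bs" for x
    proof (cases "x = a")
      case True
      then show ?thesis using assms(3) by (simp add: count_notin)
    next
      case False
      then show ?thesis using denotes_count[OF assms(1), of x] that by auto
    qed
    show "x \<in> set ?bs" if "p \<in> points (length ?as) w" "id (L p) = Inl x" for p x
      using L(3)[of p x] that by auto
  qed (use k L(4) in auto)
qed

lemma count_list_merge:
  assumes "a \<noteq> b"
  shows "count_list (map (\<lambda>x. if x = b then a else x) xs) y =
    (if y = a then count_list xs a + count_list xs b else if y = b then 0 else count_list xs y)"
  using assms by (induction xs) auto

text \<open>The local minimum joins the ends labelled \<open>a\<close> and \<open>b\<close> of the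
  diagram above. Different labels mean that two arcs become one, so one name is dropped; equal
  labels mean that an arc is closed to a curve. Since \<open>denotes\<close> lets each label occur
  exactly twice, no bottom end keeps the label in the second case, while in the first case both
  labels still occur elsewhere.\<close>

lemma denotes_Cup:
  assumes "denotes w (ys @ [a, b] @ zs) c" "i = length ys"
  shows "denotes (Cup u i # w) (map (\<lambda>x. if x = b then a else x) (ys @ zs))
    (if a = b then c + 1 else c)"
proof -
  let ?as = "ys @ [a, b] @ zs"
  define h where "h = (\<lambda>x. if x = b then a else x)"
  let ?bs = "map h (ys @ zs)"
  obtain L where "denoted_by L w ?as c"
    using assms(1) unfolding denotes_def by blast
  note L = denoted_byD[OF this]
  have k: "width_after (Cup u i) (length ?bs) = length ?as" by simp
  have t: "tangle (length ?as) w 0" using assms(1) by (rule denotes_tangle)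
  have t': "tangle (length ?bs) (Cup u i # w) 0" using t assms(2) by simp
  have count: "count_list ?as x = 2" if "x \<in> set ?as" for x
    using denotes_count[OF assms(1) that] .
  let ?P = "points (length ?as) w"
  have Li: "L (0, i) = Inl a" "L (0, i + 1) = Inl b" "(0, i) \<in> ?P" "(0, i + 1) \<in> ?P"
    using L(2)[of i] L(2)[of "i + 1"] assms(2) by (simp_all add: nth_append)
  \<comment> \<open>The two cases differ only in the relabelling \<open>f\<close>; its properties
    are collected here so that the labelling itself is checked once. The third one says that
    \<open>f\<close> identifies nothing except the labels of the two joined ends.\<close>
  have "\<exists>f :: nat + nat \<Rightarrow> nat + nat. (\<forall>x\<in>set (ys @ zs). f (Inl x) = Inl (h x)) \<and> f (Inl a) = f (Inl b) \<and>
    (\<forall>v\<in>L ` ?P. \<forall>v'\<in>L ` ?P. f v = f v' \<longrightarrow> v = v' \<or> {v, v'} \<subseteq> {Inl a, Inl b}) \<and>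
    (\<forall>p\<in>?P. \<forall>x. f (L p) = Inl x \<longrightarrow> x \<in> set ?bs) \<and>
    (if a = b then c + 1 else c) = card ((\<lambda>p. f (L p)) ` ?P \<inter> range Inr) \<and>
    (\<forall>x\<in>set ?bs. count_list ?bs x = 2)"
  proof (cases "a = b")
    case False
    have one: "count_list (ys @ zs) a = 1" "count_list (ys @ zs) b = 1"
      using count[of a] count[of b] False by simp_all
    then have ab: "a \<in> set (ys @ zs)" "b \<in> set (ys @ zs)"
      by (metis count_notin zero_neq_one)+
    let ?f = "map_sum h id :: nat + nat \<Rightarrow> nat + nat"
    have "(\<lambda>p. ?f (L p)) ` ?P \<inter> range Inr = L ` ?P \<inter> range Inr"
    proof (intro equalityI subsetI)
      fix v assume "v \<in> (\<lambda>p. ?f (L p)) ` ?P \<inter> range Inr"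
      then obtain p where p: "p \<in> ?P" "v = ?f (L p)" "v \<in> range Inr" by blast
      then have "L p = v" by (cases "L p") auto
      then show "v \<in> L ` ?P \<inter> range Inr" using p by blast
    next
      fix v assume "v \<in> L ` ?P \<inter> range Inr"
      then obtain p r where p: "p \<in> ?P" "v = Inr r" "L p = Inr r" by blast
      then have "v = ?f (L p)" by simp
      then show "v \<in> (\<lambda>p. ?f (L p)) ` ?P \<inter> range Inr" using p by blast
    qed
    then have F5: "(if a = b then c + 1 else c) = card ((\<lambda>p. ?f (L p)) ` ?P \<inter> range Inr)"
      using False L(4) by simp
    have "v = v' \<or> {v, v'} \<subseteq> {Inl a, Inl b}" if "?f v = ?f v'" for v v'
      using that by (cases v; cases v') (auto simp: h_def split: if_splits)
    then have F3: "\<forall>v\<in>L ` ?P. \<forall>v'\<in>L ` ?P. ?f v = ?f v' \<longrightarrow> v = v' \<or> {v, v'} \<subseteq> {Inl a, Inl b}"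
      by blast
    have F4: "\<forall>p\<in>?P. \<forall>x. ?f (L p) = Inl x \<longrightarrow> x \<in> set ?bs"
    proof (intro ballI allI impI)
      fix p x assume p: "p \<in> ?P" "?f (L p) = Inl x"
      obtain y where y: "L p = Inl y" "x = h y" using p(2) by (cases "L p") auto
      then have "y \<in> set (ys @ zs)" using L(3)[OF p(1), of y] ab by auto
      then show "x \<in> set ?bs" using y(2) by auto
    qed
    have F6: "\<forall>x\<in>set ?bs. count_list ?bs x = 2"
    proof
      fix x assume "x \<in> set ?bs"
      then obtain y where y: "y \<in> set (ys @ zs)" "x = h y" unfolding set_map by blast
      have "x \<noteq> a \<Longrightarrow> count_list (ys @ zs) x = 2"
        using count[of x] y False by (auto simp: h_def split: if_splits)
      then show "count_list ?bs x = 2"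
        using y False one count_list_merge[OF False, of "ys @ zs" x, folded h_def]
        by (auto simp: h_def split: if_splits)
    qed
    have F1: "\<forall>x\<in>set (ys @ zs). ?f (Inl x) = Inl (h x)" and F2: "?f (Inl a) = ?f (Inl b)"
      by (simp_all add: h_def)
    show ?thesis by (rule exI[of _ ?f], intro conjI F1 F2 F3 F4 F5 F6)
  next
    case True
    have "finite (L ` ?P)" by (simp add: finite_points)
    then have "finite (Inr -` (L ` ?P))" by (rule finite_vimageI) simp
    \<comment> \<open>The new closed curve needs a name \<open>Inr r\<close> that no closed curve of
      \<open>w\<close> carries.\<close>
    from ex_new_if_finite[OF infinite_UNIV_nat this]
    obtain r where "r \<notin> Inr -` (L ` ?P)" ..
    then have r: "Inr r \<notin> L ` ?P" by simp
    let ?f = "\<lambda>v. if v = Inl a then Inr r else v"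
    have "count_list (ys @ zs) a = 0" using count[of a] True by simp
    then have a: "a \<notin> set (ys @ zs)" by (simp add: count_list_0_iff)
    have h: "h = id" using True by (auto simp: h_def)
    have img: "(\<lambda>p. ?f (L p)) ` ?P \<inter> range Inr = insert (Inr r) (L ` ?P \<inter> range Inr)"
    proof (intro equalityI subsetI)
      fix v assume "v \<in> (\<lambda>p. ?f (L p)) ` ?P \<inter> range Inr"
      then obtain p where "p \<in> ?P" "v = ?f (L p)" "v \<in> range Inr" by blast
      then show "v \<in> insert (Inr r) (L ` ?P \<inter> range Inr)" by (cases "L p = Inl a") auto
    next
      fix v assume "v \<in> insert (Inr r) (L ` ?P \<inter> range Inr)"
      then consider "v = Inr r" | p s where "v = Inr s" "p \<in> ?P" "L p = Inr s" by auto
      then show "v \<in> (\<lambda>p. ?f (L p)) ` ?P \<inter> range Inr"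
      proof cases
        case 1
        then have "v = ?f (L (0, i))" using Li(1) by simp
        then show ?thesis using 1 Li(3) by blast
      next
        case (2 p s)
        then have "v = ?f (L p)" by simp
        then show ?thesis using 2 by blast
      qed
    qed
    have F5: "(if a = b then c + 1 else c) = card ((\<lambda>p. ?f (L p)) ` ?P \<inter> range Inr)"
      unfolding img using True r L(4) by (simp add: finite_points)
    have "v = v'" if "?f v = ?f v'" "v \<in> L ` ?P" "v' \<in> L ` ?P" for v v'
      using that r by (simp split: if_splits)
    then have F3: "\<forall>v\<in>L ` ?P. \<forall>v'\<in>L ` ?P. ?f v = ?f v' \<longrightarrow> v = v' \<or> {v, v'} \<subseteq> {Inl a, Inl b}"
      by blast
    have F4: "\<forall>p\<in>?P. \<forall>x. ?f (L p) = Inl x \<longrightarrow> x \<in> set ?bs"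
    proof (intro ballI allI impI)
      fix p x assume p: "p \<in> ?P" "?f (L p) = Inl x"
      have "L p = Inl x" "x \<noteq> a" using p(2) by (auto split: if_splits)
      then show "x \<in> set ?bs" using L(3)[OF p(1), of x] h True by auto
    qed
    have F6: "\<forall>x\<in>set ?bs. count_list ?bs x = 2"
    proof
      fix x assume "x \<in> set ?bs"
      then have "x \<in> set (ys @ zs)" "x \<noteq> a" using a by (auto simp: h)
      then show "count_list ?bs x = 2" using count[of x] True by (auto simp: h)
    qed
    have F1: "\<forall>x\<in>set (ys @ zs). ?f (Inl x) = Inl (h x)" and F2: "?f (Inl a) = ?f (Inl b)"
      using a True by (auto simp: h)
    show ?thesis by (rule exI[of _ ?f], intro conjI F1 F2 F3 F4 F5 F6)
  qed
  then obtain f :: "nat + nat \<Rightarrow> nat + nat" where f: "\<And>x. x \<in> set (ys @ zs) \<Longrightarrow> f (Inl x) = Inl (h x)" "f (Inl a) = f (Inl b)"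
    "\<And>p q. p \<in> ?P \<Longrightarrow> q \<in> ?P \<Longrightarrow> f (L p) = f (L q) \<Longrightarrow> L p = L q \<or> {L p, L q} \<subseteq> {Inl a, Inl b}"
    "\<And>p x. p \<in> ?P \<Longrightarrow> f (L p) = Inl x \<Longrightarrow> x \<in> set ?bs"
    "(if a = b then c + 1 else c) = card ((\<lambda>p. f (L p)) ` ?P \<inter> range Inr)"
    "\<And>x. x \<in> set ?bs \<Longrightarrow> count_list ?bs x = 2"
    by (elim exE conjE) (rule that; simp)
  have "denotes (Cup u i # w) ?bs (if a = b then c + 1 else c)"
  proof (rule denotes_ConsI)
    let ?C = "connected_by (all_arcs (Cup u i # w))"
    have "((1, i), (1, i + 1)) \<in> all_arcs (Cup u i # w)" by (simp add: all_arcs_Cons)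
    then have arc: "((1, i), (1, i + 1)) \<in> ?C" by (rule connected_by_arc)
    have up: "(lift_point 1 p, lift_point 1 q) \<in> ?C" if "p \<in> ?P" "q \<in> ?P" "L p = L q" for p q
      using labelled_connected[OF L(1) that] by (rule connected_by_Cons_lift)
    have low: "?bs ! j = h (?as ! j') \<and> ?as ! j' \<in> set (ys @ zs)"
      if "j < length (ys @ zs)" "j' = (if j < i then j else j + 2)" for j j'
      using that assms(2) by (auto simp: nth_append nth_Cons' Suc_diff_le)
    show "labelling (length ?bs) (Cup u i # w) (extend_labelling f (\<lambda>j. Inl (?bs ! j)) L)"
    proof (rule labelling_Cons[where l = 0], goal_cases)
      case 1 then show ?case using assms(2) by simp
    next
      case 2 then show ?case unfolding k by (rule t)
    next
      case 3 then show ?case unfolding k by (rule L(1))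
    next
      case (4 j p)
      define j' where "j' = (if j < i then j else j + 2)"
      have p: "p = (Suc 0, j')" using 4(2) by (auto simp: j'_def)
      have "j < length (ys @ zs)" using 4(1) by simp
      then have "L (0, j') = Inl (?as ! j')" by (intro L(2)) (auto simp: j'_def)
      then show ?case
        using low[OF \<open>j < length (ys @ zs)\<close> j'_def] f(1) unfolding p by simp
    next
      case 5 then show ?case using Li f(2) by auto
    next
      case (6 p q)
      then have pq: "p \<in> ?P" "q \<in> ?P" unfolding k by simp_all
      have joined: "(lift_point 1 p, (1, i)) \<in> ?C" if "p \<in> ?P" "L p \<in> {Inl a, Inl b}" for p
      proof (cases "L p = Inl a")
        case True
        then show ?thesis using up[OF that(1) Li(3)] Li(1) by simp
      next
        case False
        then have "(lift_point 1 p, (1, i + 1)) \<in> ?C" using up[OF that(1) Li(4)] Li(2) that(2) by simp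
        then show ?thesis by (rule connected_by_trans) (rule connected_by_sym[OF arc])
      qed
      show ?case
        using f(3)[OF pq 6(3)] up[OF pq] joined[OF pq(1)] joined[OF pq(2)]
          connected_by_sym connected_by_trans by (metis insert_subset)
    next
      case (7 j)
      then show ?case unfolding k
        by (intro disjI1 exI[of _ "if j < i then j else j + 2"]) auto
    qed
  qed (use t' k f(4,5,6) in \<open>auto simp del: set_map\<close>)
  then show ?thesis by (simp only: h_def)
qed

section \<open>Existence of label data and the component count of a gluing\<close>

definition no_classical :: "'a letter list \<Rightarrow> bool" where
  "no_classical w \<longleftrightarrow> (\<forall>i. Cross_R i \<notin> set w \<and> Cross_L i \<notin> set w)"

lemma no_classical_append [simp]: "no_classical (u @ w) \<longleftrightarrow> no_classical u \<and> no_classical w"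
  by (auto simp: no_classical_def)

lemma no_classical_simps [simp]:
  "no_classical []" "no_classical (Cup b i # w) \<longleftrightarrow> no_classical w"
  "no_classical (Cap i # w) \<longleftrightarrow> no_classical w" "no_classical (Virt i # w) \<longleftrightarrow> no_classical w"
  "\<not> no_classical (Cross_R i # w)" "\<not> no_classical (Cross_L i # w)"
  by (auto simp: no_classical_def)

lemma split_at_pair:
  assumes "i + 1 < length xs"
  obtains ys a b zs where "xs = ys @ [a, b] @ zs" "length ys = i"
proof
  show "xs = take i xs @ [xs ! i, xs ! (i + 1)] @ drop (i + 2) xs"
    using assms by (simp add: Cons_nth_drop_Suc id_take_nth_drop[symmetric])
qed (use assms in simp)

text \<open>The recursion removes the bottom letter, so labels propagate from the top of the diagram
  downwards, with a fresh label at each local maximum.\<close>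

lemma denotes_exists:
  "no_classical w \<Longrightarrow> tangle k w 0 \<Longrightarrow> \<exists>as c. denotes w as c \<and> length as = k"
proof (induction w arbitrary: k)
  case Nil
  then show ?case using denotes_Nil by auto
next
  case (Cons x w)
  have "no_classical w" using Cons.prems(1) by (cases x) auto
  then obtain as c where w: "denotes w as c" "length as = width_after x k"
    using Cons.IH[of "width_after x k"] Cons.prems(2) by auto
  show ?case
  proof (cases x)
    case (Cup u i)
    then have "i + 1 < length as" using w(2) Cons.prems(2) by simp
    then obtain ys a b zs where "as = ys @ [a, b] @ zs" "length ys = i" by (rule split_at_pair)
    then show ?thesis
      using denotes_Cup[of w ys a b zs c i u] w Cup by fastforce
  next
    case (Cap i)
    obtain a where a: "a \<notin> set as" using ex_new_if_finite[OF infinite_UNIV_nat] by blast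
    have "i \<le> length as" using w(2) Cons.prems(2) Cap by auto
    then have "denotes (Cap i # w) (take i as @ [a, a] @ drop i as) c"
      using w(1) a by (intro denotes_Cap) auto
    moreover have "length (take i as @ [a, a] @ drop i as) = k"
      using w(2) Cons.prems(2) Cap by auto
    ultimately show ?thesis using Cap by blast
  next
    case (Virt i)
    then have "i + 1 < length as" using w(2) Cons.prems(2) by simp
    then obtain ys a b zs where "as = ys @ [a, b] @ zs" "length ys = i" by (rule split_at_pair)
    then show ?thesis
      using denotes_Virt[of w ys a b zs c i] w Virt by fastforce
  qed (use Cons.prems in auto)
qed

text \<open>The share of \<open>u\<close> in the component count of a gluing. The upper diagram
  enters only through the equality pattern of its labels, which makes different exteriors
  comparable.\<close>

definition glued :: "'a letter list \<Rightarrow> nat list \<Rightarrow> nat" where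
  "glued u as = card (points 0 u // connected_by (all_arcs u \<union>
     {((length u, i), (length u, j)) | i j. i < length as \<and> j < length as \<and> as ! i = as ! j}))"

lemma glued_cong:
  assumes "length as = length bs"
    and "\<And>i j. i < length as \<Longrightarrow> j < length as \<Longrightarrow> as ! i = as ! j \<longleftrightarrow> bs ! i = bs ! j"
  shows "glued u as = glued u bs"
proof -
  have "{((length u, i), (length u, j)) | i j. i < length as \<and> j < length as \<and> as ! i = as ! j} =
      {((length u, i), (length u, j)) | i j. i < length bs \<and> j < length bs \<and> bs ! i = bs ! j}"
    using assms by auto
  then show ?thesis by (simp only: glued_def)
qed

text \<open>Protects the truncated subtraction in the exponent of \<open>bracket_from\<close> when
  closed curves are split off.\<close>

lemma glued_pos:
  assumes "tangle 0 u (length as)" "as \<noteq> []"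
  shows "0 < glued u as"
proof -
  have "(length u, 0) \<in> points 0 u" using top_in_points[OF assms(1)] assms(2) by simp
  moreover have "finite (points 0 u // R)" for R
    by (auto simp: quotient_def finite_points)
  ultimately show ?thesis unfolding glued_def by (auto simp: card_gt_0_iff quotient_def)
qed

lemma all_arcs_level: "(p, q) \<in> all_arcs u \<Longrightarrow> fst p \<le> length u \<and> fst q \<le> length u"
proof -
  assume "(p, q) \<in> all_arcs u"
  then obtain h where "h < length u" "(p, q) \<in> arcs h (u ! h)" by (auto simp: all_arcs_def)
  then show ?thesis by (cases "u ! h") auto
qed

lemma low_in_points_append: "fst p \<le> length u \<Longrightarrow> p \<in> points k (u @ w) \<longleftrightarrow> p \<in> points k u"
  by (auto simp: points_def)

lemma lift_in_points_append:
  "tangle k u r \<Longrightarrow> lift_point (length u) p \<in> points k (u @ w) \<longleftrightarrow> p \<in> points r w"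
  by (cases p) (simp add: points_def fold_width_after)

text \<open>A component either reaches \<open>u\<close>, and is then named by its class there after
  identifying equally labelled top ends, or it is a closed curve of \<open>w\<close>. The two kinds
  of names are the summands of \<open>point set + nat\<close>.\<close>

lemma num_components_glue:
  assumes u: "tangle 0 u (length as)" and w: "denotes w as c"
  shows "num_components (u @ w) = glued u as + c"
proof -
  let ?k = "length as" and ?m = "length u"
  let ?K = "{((?m, i), (?m, j)) | i j. i < ?k \<and> j < ?k \<and> as ! i = as ! j}"
  let ?D = "connected_by (all_arcs u \<union> ?K)" and ?C = "connected_by (all_arcs (u @ w))"
  let ?V = "points 0 u" and ?P = "points ?k w"
  obtain L where L: "denoted_by L w as c" using w unfolding denotes_def by blast
  note L = denoted_byD[OF L]
  have tw: "tangle ?k w 0" using w by (rule denotes_tangle)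
  have t: "tangle 0 (u @ w) 0" using u tw by (auto simp: tangle_append)
  define cl where "cl = (\<lambda>p. ?D `` {p})"
  have cl: "cl p = cl q \<longleftrightarrow> (p, q) \<in> ?D" for p q
    unfolding cl_def using eq_equiv_class_iff[OF equiv_connected_by UNIV_I UNIV_I] .
  \<comment> \<open>\<open>SOME\<close> picks any top end of \<open>u\<close> that carries the
    label; by \<open>G_bottom\<close> the class does not depend on the choice.\<close>
  define G :: "nat + nat \<Rightarrow> point set + nat" where "G = (\<lambda>v. case v of Inl a \<Rightarrow> Inl (cl (?m, SOME i. i < ?k \<and> as ! i = a)) | Inr r \<Rightarrow> Inr r)"
  define M where "M = (\<lambda>p. if p \<in> ?V then Inl (cl p) else G (L (fst p - ?m, snd p)))"
  have G_bottom: "G (Inl (as ! j)) = Inl (cl (?m, j))" if "j < ?k" for j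
  proof -
    have "(SOME i. i < ?k \<and> as ! i = as ! j) < ?k \<and> as ! (SOME i. i < ?k \<and> as ! i = as ! j) = as ! j"
      by (rule someI[of _ j]) (use that in simp)
    then have "((?m, SOME i. i < ?k \<and> as ! i = as ! j), (?m, j)) \<in> ?D"
      using that by (intro connected_by_arc) blast
    then show ?thesis unfolding G_def using cl by simp
  qed
  have low: "M p = Inl (cl p)" if "p \<in> ?V" for p using that by (simp add: M_def)
  \<comment> \<open>The interface level belongs to both parts, so the two branches of
    \<open>M\<close> have to agree there.\<close>
  have high: "M (lift_point ?m q) = G (L q)" if q: "q \<in> ?P" for q
  proof (cases "lift_point ?m q \<in> ?V")
    case True
    obtain h j where hj: "q = (h, j)" by force
    then have "h = 0" using True by (auto simp: points_def)
    then have "j < ?k" using q hj by simp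
    then show ?thesis using low[OF True] hj \<open>h = 0\<close> L(2) G_bottom by simp
  next
    case False
    then show ?thesis by (cases q) (simp add: M_def)
  qed
  have points: "points 0 (u @ w) = ?V \<union> lift_point ?m ` ?P" by (rule points_append[OF u])
  have lift: "(lift_point ?m p, lift_point ?m q) \<in> ?C" if "(p, q) \<in> connected_by (all_arcs w)" for p q
    using that by (rule connected_by_lift) (simp add: all_arcs_append)
  have D_C: "(p, q) \<in> ?C" if "(p, q) \<in> ?D" for p q
    using that
  proof (rule connected_by_mono[where f = "\<lambda>p. p"])
    fix p q assume "(p, q) \<in> all_arcs u \<union> ?K"
    then consider "(p, q) \<in> all_arcs u"
      | i j where "p = (?m, i)" "q = (?m, j)" "i < ?k" "j < ?k" "as ! i = as ! j" by blast
    then show "(p, q) \<in> ?C"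
    proof cases
      case 1
      then show ?thesis by (auto intro!: connected_by_arc simp: all_arcs_append)
    next
      case (2 i j)
      then have "((0, i), (0, j)) \<in> connected_by (all_arcs w)"
        by (intro labelled_connected[OF L(1)]) (simp_all add: L(2))
      from lift[OF this] show ?thesis using 2 by simp
    qed
  qed
  have lab: "labelling 0 (u @ w) M"
    unfolding labelling_def
  proof (intro conjI ballI impI)
    fix p q assume pq: "p \<in> points 0 (u @ w)" "q \<in> points 0 (u @ w)" "(p, q) \<in> all_arcs (u @ w)"
    from pq(3) consider "(p, q) \<in> all_arcs u"
      | p' q' where "p = lift_point ?m p'" "q = lift_point ?m q'" "(p', q') \<in> all_arcs w"
      unfolding all_arcs_append by auto
    then show "M p = M q"
    proof cases
      case 1
      then have "p \<in> ?V" "q \<in> ?V"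
        using pq(1,2) all_arcs_level[OF 1] low_in_points_append by blast+
      moreover have "(p, q) \<in> ?D" using 1 by (auto intro: connected_by_arc)
      ultimately show ?thesis using low cl by simp
    next
      case (2 p' q')
      then have *: "p' \<in> ?P" "q' \<in> ?P" using pq(1,2) lift_in_points_append[OF u] by blast+
      then have "L p' = L q'"
        using labelling_connected[OF L(1) tw connected_by_arc[OF 2(3)]] by simp
      then show ?thesis using high * 2 by simp
    qed
  next
    fix p q assume pq: "p \<in> points 0 (u @ w)" "q \<in> points 0 (u @ w)" "M p = M q"
    \<comment> \<open>Every point can be moved into \<open>u\<close>, or else lies on a closed curve
      of \<open>w\<close>. This reduces injectivity of the names to \<open>?D\<close> in the first
      case and to \<open>L\<close> in the second.\<close>
    have kinds: "(\<exists>s\<in>?V. M p = Inl (cl s) \<and> (p, s) \<in> ?C) \<or>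
        (\<exists>p'\<in>?P. \<exists>r. p = lift_point ?m p' \<and> L p' = Inr r \<and> M p = Inr r)"
      if p: "p \<in> points 0 (u @ w)" for p
    proof (cases "p \<in> ?V")
      case True
      then show ?thesis using low by blast
    next
      case False
      then obtain p' where p': "p' \<in> ?P" "p = lift_point ?m p'" using p points by blast
      show ?thesis
      proof (cases "L p'")
        case (Inl a)
        then obtain j where j: "j < ?k" "as ! j = a"
          using L(3)[OF p'(1) Inl] by (auto simp: in_set_conv_nth)
        then have "L (0, j) = L p'" using L(2) Inl by simp
        then have "(p', (0, j)) \<in> connected_by (all_arcs w)"
          using j p'(1) by (intro labelled_connected[OF L(1)]) simp_all
        from lift[OF this] have "(p, (?m, j)) \<in> ?C" using p' by simp
        moreover have "M p = Inl (cl (?m, j))" using high[OF p'(1)] p'(2) Inl G_bottom[OF j(1)] j by simp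
        moreover have "(?m, j) \<in> ?V" using top_in_points[OF u] j by simp
        ultimately show ?thesis by blast
      next
        case (Inr r)
        then show ?thesis using p' high[OF p'(1)] by (auto simp: G_def)
      qed
    qed
    show "(p, q) \<in> ?C"
      using kinds[OF pq(1)]
    proof (elim disjE bexE exE conjE)
      fix s assume s: "s \<in> ?V" "M p = Inl (cl s)" "(p, s) \<in> ?C"
      then obtain s' where s': "s' \<in> ?V" "M q = Inl (cl s')" "(q, s') \<in> ?C"
        using kinds[OF pq(2)] pq(3) by auto
      have "cl s = cl s'" using s(2) s'(2) pq(3) by simp
      then have "(s, s') \<in> ?C" unfolding cl by (rule D_C)
      then show ?thesis using s(3) s'(3) connected_by_sym connected_by_trans by metis
    next
      fix p' r assume *: "p' \<in> ?P" "p = lift_point ?m p'" "L p' = Inr r" "M p = Inr r"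
      then obtain q' where **: "q' \<in> ?P" "q = lift_point ?m q'" "L q' = Inr r"
        using kinds[OF pq(2)] pq(3) by auto
      have "(p', q') \<in> connected_by (all_arcs w)"
        using * ** by (intro labelled_connected[OF L(1)]) simp_all
      then show ?thesis using lift * ** by simp
    qed
  qed
  let ?R = "{r. Inr r \<in> L ` ?P}"
  have "M ` points 0 (u @ w) = Inl ` cl ` ?V \<union> Inr ` ?R"
  proof (intro equalityI subsetI)
    fix v assume "v \<in> M ` points 0 (u @ w)"
    then consider p where "p \<in> ?V" "v = M p" | q where "q \<in> ?P" "v = M (lift_point ?m q)"
      unfolding points by blast
    then show "v \<in> Inl ` cl ` ?V \<union> Inr ` ?R"
    proof cases
      case 1
      then show ?thesis using low by simp
    next
      case (2 q)
      show ?thesis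
      proof (cases "L q")
        case (Inl a)
        then obtain j where j: "j < ?k" "as ! j = a"
          using L(3)[OF 2(1) Inl] by (auto simp: in_set_conv_nth)
        then have "v = Inl (cl (?m, j))" using 2 high Inl G_bottom by auto
        moreover have "(?m, j) \<in> ?V" using top_in_points[OF u] j by simp
        ultimately show ?thesis by blast
      next
        case (Inr r)
        then have "v = Inr r" using 2 high by (simp add: G_def)
        moreover have "r \<in> ?R" using 2(1) Inr by (metis imageI mem_Collect_eq)
        ultimately show ?thesis by blast
      qed
    qed
  next
    fix v assume "v \<in> Inl ` cl ` ?V \<union> Inr ` ?R"
    then consider p where "p \<in> ?V" "v = Inl (cl p)" | r where "v = Inr r" "Inr r \<in> L ` ?P" by blast
    then show "v \<in> M ` points 0 (u @ w)"
    proof cases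
      case 1
      then show ?thesis using low points by (metis UnI1 imageI)
    next
      case (2 r)
      then obtain q where q: "q \<in> ?P" "L q = Inr r" by (metis imageE)
      then have "v = M (lift_point ?m q)" using high 2 by (simp add: G_def)
      then show ?thesis using q points by blast
    qed
  qed
  moreover have "finite ?R"
  proof -
    have "finite (Inr -` (L ` ?P))" by (rule finite_vimageI) (simp_all add: finite_points)
    then show ?thesis by (simp add: vimage_def)
  qed
  moreover have "card (Inl ` cl ` ?V \<union> Inr ` ?R :: (point set + nat) set) = card (cl ` ?V) + card ?R"
    if "finite ?R"
  proof -
    have "card (Inl ` cl ` ?V \<union> Inr ` ?R :: (point set + nat) set) =
        card (Inl ` cl ` ?V :: (point set + nat) set) + card (Inr ` ?R :: (point set + nat) set)"
      by (rule card_Un_disjoint) (use that in \<open>auto simp: finite_points\<close>)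
    then show ?thesis by (simp add: card_image)
  qed
  moreover have "c = card ?R"
  proof -
    have "L ` ?P \<inter> range Inr = Inr ` ?R"
    proof (intro equalityI subsetI)
      fix v assume "v \<in> L ` ?P \<inter> range Inr"
      then obtain r where "v = Inr r" "v \<in> L ` ?P" by (elim IntE rangeE)
      then show "v \<in> Inr ` ?R" by simp
    qed auto
    then show ?thesis using L(4) by (simp add: card_image)
  qed
  moreover have "cl ` ?V = ?V // ?D" by (auto simp: cl_def quotient_def)
  moreover have "num_components (u @ w) = card (M ` points 0 (u @ w))"
    unfolding num_components_def by (rule card_components[OF lab t])
  ultimately show ?thesis by (simp add: glued_def)
qed

section \<open>Smoothing the modified crossings\<close>

lemma bracket_from_no_classical:
  "no_classical w \<Longrightarrow> bracket_from p w = loop_value ^ (num_components (p @ w) - 1)"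
proof (induction w arbitrary: p)
  case (Cons x w)
  then show ?case by (cases x) auto
qed simp

lemma tangle_hook: "i + 1 < k \<Longrightarrow> tangle k [Cap i, Cup () i] k"
  by auto

lemma tangle_smooth:
  assumes "tangle 0 (p @ x # u) k" "x = Cross_R i \<or> x = Cross_L i"
  shows "tangle 0 (p @ u) k" "tangle 0 ((p @ [Cap i, Cup () i]) @ u) k"
proof -
  obtain r where "tangle 0 p r" "tangle r (x # u) k" using assms(1) by (auto simp: tangle_append)
  then show "tangle 0 (p @ u) k" "tangle 0 ((p @ [Cap i, Cup () i]) @ u) k"
    using assms(2) tangle_hook[of i r] by (auto simp: tangle_append)
qed

text \<open>The induction runs through \<open>u\<close> only, \<open>p\<close> collecting the part
  already smoothed, so the crossings of \<open>u\<close> are resolved in the same way in front of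
  \<open>w\<close> and \<open>w'\<close>. In the end the component counts differ by
  \<open>r\<close>; for positive \<open>r\<close> the condition \<open>as \<noteq> []\<close> keeps
  the subtraction of 1 from truncating.\<close>

lemma bracket_from_transfer:
  assumes "no_classical w" "no_classical w'" "denotes w as (c + r)" "denotes w' bs c"
    and "length bs = length as" "r = 0 \<or> as \<noteq> []"
    and "\<And>i j. i < length as \<Longrightarrow> j < length as \<Longrightarrow> as ! i = as ! j \<longleftrightarrow> bs ! i = bs ! j"
  shows "tangle 0 (p @ u) (length as) \<Longrightarrow>
    bracket_from p (u @ w) = loop_value ^ r * bracket_from p (u @ w')"
proof (induction u arbitrary: p)
  case Nil
  have g: "glued p bs = glued p as" using assms(5,7) by (intro glued_cong) auto
  have "num_components (p @ w) = glued p as + c + r"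
    using num_components_glue[of p as w "c + r"] Nil assms(3) by simp
  moreover have "num_components (p @ w') = glued p as + c"
    using num_components_glue[of p bs w' c] Nil assms(4,5) g by simp
  moreover have "r = 0 \<or> 0 < glued p as" using glued_pos[of p as] Nil assms(6) by auto
  ultimately have "num_components (p @ w) - 1 = r + (num_components (p @ w') - 1)" by auto
  then show ?case using assms(1,2) by (simp add: bracket_from_no_classical power_add)
next
  case (Cons x u)
  have lin: "a * (c * y) + b * (c * z) = c * (a * y + b * z)" for a b c y z :: laurent
    by (simp only: distrib_left ac_simps)
  show ?case
  proof (cases x)
    case (Cross_R i)
    then have "tangle 0 (p @ u) (length as)" "tangle 0 ((p @ [Cap i, Cup () i]) @ u) (length as)"
      using tangle_smooth[OF Cons.prems] by auto
    from Cons.IH[OF this(1)] Cons.IH[OF this(2)] show ?thesis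
      by (simp only: Cross_R append_Cons bracket_from.simps lin)
  next
    case (Cross_L i)
    then have "tangle 0 (p @ u) (length as)" "tangle 0 ((p @ [Cap i, Cup () i]) @ u) (length as)"
      using tangle_smooth[OF Cons.prems] by auto
    from Cons.IH[OF this(1)] Cons.IH[OF this(2)] show ?thesis
      by (simp only: Cross_L append_Cons bracket_from.simps lin)
  qed (use Cons.IH[of "p @ [x]"] Cons.prems in auto)
qed

lemma bracket_transfer:
  assumes "no_classical w" "no_classical w'" "denotes w as (c + r)" "denotes w' bs c"
    and "length bs = length as" "r = 0 \<or> as \<noteq> []"
    and "\<And>i j. i < length as \<Longrightarrow> j < length as \<Longrightarrow> as ! i = as ! j \<longleftrightarrow> bs ! i = bs ! j"
    and "tangle 0 u (length as)"
  shows "bracket (u @ w) = loop_value ^ r * bracket (u @ w')"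
  unfolding bracket_def using bracket_from_transfer[OF assms(1-7), of "[]" u] assms(8) by simp

lemma bracket_eq:
  assumes "no_classical w" "no_classical w'" "denotes w as c" "denotes w' as c" "tangle 0 u (length as)"
  shows "bracket (u @ w) = bracket (u @ w')"
  using bracket_transfer[of w w' as c 0 as u] assms by simp

text \<open>Four ends admit three pairings: opposite ends (\<open>acts_as_swap\<close>), lower with
  upper on each side (\<open>acts_as_id\<close>), lower with lower and upper with upper
  (\<open>acts_as_hook\<close>). Expressing them as actions on the labels of every diagram above
  makes virtual detours invisible.\<close>

definition acts_as_swap :: "(nat \<Rightarrow> diagram) \<Rightarrow> bool" where
  "acts_as_swap g \<longleftrightarrow> (\<forall>ys a b zs c w. denotes w (ys @ [a, b] @ zs) c \<longrightarrow>
     denotes (g (length ys) @ w) (ys @ [b, a] @ zs) c)"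

definition acts_as_id :: "(nat \<Rightarrow> diagram) \<Rightarrow> bool" where
  "acts_as_id g \<longleftrightarrow> (\<forall>ys a b zs c w. denotes w (ys @ [a, b] @ zs) c \<longrightarrow>
     denotes (g (length ys) @ w) (ys @ [a, b] @ zs) c)"

abbreviation rename :: "'b \<Rightarrow> 'b \<Rightarrow> 'b list \<Rightarrow> 'b list" where
  "rename b a \<equiv> map (\<lambda>x. if x = b then a else x)"

definition acts_as_hook :: "(nat \<Rightarrow> diagram) \<Rightarrow> bool" where
  "acts_as_hook g \<longleftrightarrow> (\<forall>ys a b zs c w e. denotes w (ys @ [a, b] @ zs) c \<longrightarrow>
     e \<notin> set (ys @ [a, b] @ zs) \<longrightarrow>
     denotes (g (length ys) @ w) (rename b a ys @ [e, e] @ rename b a zs) (if a = b then c + 1 else c))"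

lemma rename_fresh: "b \<notin> set xs \<Longrightarrow> rename b a xs = xs"
  by (induction xs) auto

lemma ex_fresh: "\<exists>e :: nat. e \<notin> set xs"
  by (rule ex_new_if_finite[OF infinite_UNIV_nat]) simp

text \<open>A quarter turn permutes the four ends cyclically: it preserves the pairing of opposite
  ends and exchanges the other two, which gives the two lemmas that follow.\<close>

lemma swap_turn:
  assumes "acts_as_swap g" shows "acts_as_swap (quarter_turn g)"
  unfolding acts_as_swap_def
proof (intro allI impI)
  fix ys zs :: "nat list" and a b c and w :: diagram
  assume w: "denotes w (ys @ [a, b] @ zs) c"
  obtain e where e: "e \<notin> set (ys @ [a, b] @ zs)" using ex_fresh by blast
  \<comment> \<open>The fresh \<open>e\<close> names the arc that bends down on the right. The piece
    moves one copy of \<open>e\<close> next to \<open>a\<close>, and the local minimum on the left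
    then renames \<open>e\<close> to \<open>a\<close>.\<close>
  have "denotes (Cap (length ys + 2) # w) ((ys @ [a, b]) @ [e, e] @ zs) c"
    by (rule denotes_Cap) (use w e in auto)
  then have "denotes (g (length ys + 1) @ Cap (length ys + 2) # w) (ys @ [a, e] @ b # e # zs) c"
    using assms[unfolded acts_as_swap_def, rule_format, of _ "ys @ [a]" b e "e # zs"] by simp
  from denotes_Cup[OF this refl, of "()"]
  show "denotes (quarter_turn g (length ys) @ w) (ys @ [b, a] @ zs) c"
    using e by (simp add: quarter_turn_def rename_fresh)
qed

lemma hook_turn:
  assumes "acts_as_id g" shows "acts_as_hook (quarter_turn g)"
  unfolding acts_as_hook_def
proof (intro allI impI)
  fix ys zs :: "nat list" and a b c e and w :: diagram
  assume w: "denotes w (ys @ [a, b] @ zs) c" and e: "e \<notin> set (ys @ [a, b] @ zs)"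
  have "denotes (Cap (length ys + 2) # w) ((ys @ [a, b]) @ [e, e] @ zs) c"
    by (rule denotes_Cap) (use w e in auto)
  then have "denotes (g (length ys + 1) @ Cap (length ys + 2) # w) (ys @ [a, b] @ e # e # zs) c"
    using assms[unfolded acts_as_id_def, rule_format, of _ "ys @ [a]" b e "e # zs"] by simp
  from denotes_Cup[OF this refl, of "()"]
  show "denotes (quarter_turn g (length ys) @ w)
      (rename b a ys @ [e, e] @ rename b a zs) (if a = b then c + 1 else c)"
    using e by (simp add: quarter_turn_def)
qed

lemma id_turn:
  assumes "acts_as_hook g" shows "acts_as_id (quarter_turn g)"
  unfolding acts_as_id_def
proof (intro allI impI)
  fix ys zs :: "nat list" and a b c and w :: diagram
  assume w: "denotes w (ys @ [a, b] @ zs) c"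
  obtain e where e: "e \<notin> set (ys @ [a, b] @ zs)" using ex_fresh by blast
  \<comment> \<open>Two temporary names are needed: \<open>e\<close> for the outer local maximum,
    absorbed into \<open>b\<close> by the upper half of the hook, and \<open>e'\<close> for the
    lower half, absorbed into \<open>a\<close> by the local minimum.\<close>
  obtain e' where e': "e' \<notin> set (ys @ [a, b, e] @ zs)" using ex_fresh by blast
  have "denotes (Cap (length ys + 2) # w) ((ys @ [a, b]) @ [e, e] @ zs) c"
    by (rule denotes_Cap) (use w e in auto)
  then have "denotes (g (length ys + 1) @ Cap (length ys + 2) # w)
      (rename e b (ys @ [a]) @ [e', e'] @ rename e b (e # zs)) (if b = e then c + 1 else c)"
    using assms[unfolded acts_as_hook_def, rule_format, of _ "ys @ [a]" b e "e # zs" c e'] e' by simp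
  then have "denotes (g (length ys + 1) @ Cap (length ys + 2) # w) (ys @ [a, e'] @ e' # b # zs) c"
    using e by (simp add: rename_fresh)
  then have "denotes (Cup () (length ys) # g (length ys + 1) @ Cap (length ys + 2) # w)
      (rename e' a (ys @ e' # b # zs)) (if a = e' then c + 1 else c)"
    by (rule denotes_Cup) simp
  then show "denotes (quarter_turn g (length ys) @ w) (ys @ [a, b] @ zs) c"
    using e' by (simp add: quarter_turn_def rename_fresh)
qed

text \<open>The skein identity is required between arbitrary words, so the modified crossings of one
  exterior can be expanded one after another.\<close>

definition smooths :: "(nat \<Rightarrow> diagram) \<Rightarrow> (nat \<Rightarrow> diagram) \<Rightarrow> (nat \<Rightarrow> diagram) \<Rightarrow> bool" where
  "smooths g gA gB \<longleftrightarrow>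
     (\<forall>u i w. bracket (u @ g i @ w) =
        A_pow 1 * bracket (u @ gA i @ w) + A_pow (- 1) * bracket (u @ gB i @ w)) \<and>
     (\<forall>i. no_classical (gA i) \<and> no_classical (gB i)) \<and>
     (\<forall>i k. i + 1 < k \<longrightarrow> tangle k (gA i) k \<and> tangle k (gB i) k)"

lemma smooths_turn:
  assumes "smooths g gA gB"
  shows "smooths (quarter_turn g) (quarter_turn gA) (quarter_turn gB)"
proof -
  have "bracket (u @ quarter_turn g i @ w) = A_pow 1 * bracket (u @ quarter_turn gA i @ w) +
      A_pow (- 1) * bracket (u @ quarter_turn gB i @ w)" for u i w
    using assms[unfolded smooths_def, THEN conjunct1, rule_format, of "u @ [Cup () i]" "i + 1" "Cap (i + 2) # w"]
    by (simp add: quarter_turn_def)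
  moreover have "tangle k (quarter_turn h i) k"
    if "\<forall>i k. i + 1 < k \<longrightarrow> tangle k (h i) k" "i + 1 < k" for h i k
  proof -
    have "tangle (k + 2) (h (i + 1)) (k + 2)" using that by simp
    then show ?thesis using that(2) by (auto simp: quarter_turn_def tangle_append)
  qed
  moreover have "no_classical (quarter_turn h i)" if "\<forall>i. no_classical (h i)" for h i
    using that by (simp add: quarter_turn_def)
  ultimately show ?thesis using assms by (simp add: smooths_def)
qed

text \<open>\<open>modified\<close> with its classical crossing deleted. Three virtual crossings
  pair the ends like a single one, so this smoothing restores the original crossing, with
  coefficient \<open>A_pow 1\<close>.\<close>

definition modified_A :: "nat \<Rightarrow> diagram" where
  "modified_A i = [Virt i, Virt i, Virt i]"

text \<open>The horizontal smoothing. Below the local maximum a virtual crossing exchanges two ends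
  of the same arc, and above the local minimum two virtual crossings undo each other, so no genuine
  crossing survives.\<close>

definition modified_B :: "nat \<Rightarrow> diagram" where
  "modified_B i = [Virt i, Cap i, Cup () i, Virt i, Virt i]"

lemma smooths_modified: "smooths modified modified_A modified_B"
proof -
  have "bracket (u @ modified i @ w) =
      A_pow 1 * bracket (u @ modified_A i @ w) + A_pow (- 1) * bracket (u @ modified_B i @ w)" for u i w
    using bracket_skein(1)[of "u @ [Virt i]" i "[Virt i, Virt i] @ w"]
    by (simp add: modified_def picture_def modified_A_def modified_B_def)
  then show ?thesis
    by (auto simp: smooths_def modified_A_def modified_B_def)
qed

lemma swap_modified_A: "acts_as_swap modified_A"
  unfolding acts_as_swap_def modified_A_def
  by (auto intro!: denotes_Virt[of _ _ _ _ _ _ "length _", simplified])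

lemma hook_acts: "acts_as_hook (\<lambda>i. [Cap i, Cup () i])"
  unfolding acts_as_hook_def
proof (intro allI impI)
  fix ys zs :: "nat list" and a b c e and w :: diagram
  assume w: "denotes w (ys @ [a, b] @ zs) c" and e: "e \<notin> set (ys @ [a, b] @ zs)"
  have "denotes (Cup () (length ys) # w) (rename b a ys @ rename b a zs) (if a = b then c + 1 else c)"
    using denotes_Cup[OF w refl] by simp
  then have "denotes (Cap (length ys) # Cup () (length ys) # w)
      (rename b a ys @ [e, e] @ rename b a zs) (if a = b then c + 1 else c)"
    by (rule denotes_Cap) (use e in auto)
  then show "denotes ([Cap (length ys), Cup () (length ys)] @ w)
      (rename b a ys @ [e, e] @ rename b a zs) (if a = b then c + 1 else c)" by simp
qed

lemma hook_modified_B: "acts_as_hook modified_B"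
  unfolding acts_as_hook_def
proof (intro allI impI)
  fix ys zs :: "nat list" and a b c e and w :: diagram
  assume w: "denotes w (ys @ [a, b] @ zs) c" and e: "e \<notin> set (ys @ [a, b] @ zs)"
  let ?i = "length ys"
  have "denotes (Virt ?i # Virt ?i # w) (ys @ [a, b] @ zs) c"
    by (intro denotes_Virt w refl)
  then have "denotes ([Cap ?i, Cup () ?i] @ Virt ?i # Virt ?i # w)
      (rename b a ys @ [e, e] @ rename b a zs) (if a = b then c + 1 else c)"
    using hook_acts e unfolding acts_as_hook_def by blast
  from denotes_Virt[OF this refl]
  show "denotes (modified_B ?i @ w) (rename b a ys @ [e, e] @ rename b a zs) (if a = b then c + 1 else c)"
    by (simp add: modified_B_def)
qed

lemma denotes_pair:
  assumes "no_classical w" "tangle k w 0" "i + 1 < k"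
  obtains ys a b zs c where "denotes w (ys @ [a, b] @ zs) c" "length ys = i" "k = length (ys @ [a, b] @ zs)"
proof -
  obtain as c where "denotes w as c" "length as = k" using denotes_exists[OF assms(1,2)] by blast
  moreover from this(2) assms(3) have "i + 1 < length as" by simp
  then obtain ys a b zs where "as = ys @ [a, b] @ zs" "length ys = i" by (rule split_at_pair)
  ultimately show ?thesis using that by blast
qed

lemma bracket_swap:
  assumes "acts_as_swap g" "\<And>i. no_classical (g i)"
    and "tangle 0 u k" "i + 1 < k" "tangle k w 0" "no_classical w"
  shows "bracket (u @ g i @ w) = bracket (u @ Virt i # w)"
proof -
  obtain ys a b zs c where w: "denotes w (ys @ [a, b] @ zs) c" "length ys = i" "k = length (ys @ [a, b] @ zs)"
    using assms by (elim denotes_pair)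
  have "denotes (g i @ w) (ys @ [b, a] @ zs) c"
    using assms(1) w(1,2) unfolding acts_as_swap_def by blast
  moreover have "denotes (Virt i # w) (ys @ [b, a] @ zs) c"
    using w(1,2) by (intro denotes_Virt) auto
  ultimately show ?thesis by (rule bracket_eq[rotated 2]) (use assms w in auto)
qed

lemma bracket_id:
  assumes "acts_as_id g" "\<And>i. no_classical (g i)"
    and "tangle 0 u k" "i + 1 < k" "tangle k w 0" "no_classical w"
  shows "bracket (u @ g i @ w) = bracket (u @ w)"
proof -
  obtain ys a b zs c where w: "denotes w (ys @ [a, b] @ zs) c" "length ys = i" "k = length (ys @ [a, b] @ zs)"
    using assms by (elim denotes_pair)
  have "denotes (g i @ w) (ys @ [a, b] @ zs) c"
    using assms(1) w(1,2) unfolding acts_as_id_def by blast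
  then show ?thesis by (rule bracket_eq[rotated 2, OF _ w(1)]) (use assms w in auto)
qed

lemma bracket_hook:
  assumes "acts_as_hook g" "\<And>i. no_classical (g i)"
    and "tangle 0 u k" "i + 1 < k" "tangle k w 0" "no_classical w"
  shows "bracket (u @ g i @ w) = bracket (u @ [Cap i, Cup () i] @ w)"
proof -
  obtain ys a b zs c where w: "denotes w (ys @ [a, b] @ zs) c" "length ys = i" "k = length (ys @ [a, b] @ zs)"
    using assms by (elim denotes_pair)
  obtain e where e: "e \<notin> set (ys @ [a, b] @ zs)" using ex_fresh by blast
  have "denotes (g i @ w) (rename b a ys @ [e, e] @ rename b a zs) (if a = b then c + 1 else c)"
    using assms(1) w(1,2) e unfolding acts_as_hook_def by blast
  moreover have "denotes ([Cap i, Cup () i] @ w) (rename b a ys @ [e, e] @ rename b a zs) (if a = b then c + 1 else c)"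
    using hook_acts w(1,2) e unfolding acts_as_hook_def by blast
  ultimately show ?thesis by (rule bracket_eq[rotated 2]) (use assms w in auto)
qed

text \<open>Turning does not affect the pairing made by the first smoothing and alternates that of
  the second between hook and identity; hence \<open>Q\<close>, which has no virtual crossing in any
  case. Replacing \<open>PA\<close> and \<open>PB\<close> uses label data and thus an upper word
  without classical crossings, whereas the skein identity holds for all \<open>w\<close>.\<close>

lemma modified_crossing_smooths:
  obtains PA PB Q where
    "\<And>u w. bracket (u @ modified_crossing d h i @ w) =
       A_pow 1 * bracket (u @ PA @ w) + A_pow (- 1) * bracket (u @ PB @ w)"
    "\<And>k. i + 1 < k \<Longrightarrow> tangle k PA k" "\<And>k. i + 1 < k \<Longrightarrow> tangle k PB k"
    "Q = [] \<or> Q = [Cap i, Cup () i]"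
    "\<And>u k w. tangle 0 u k \<Longrightarrow> i + 1 < k \<Longrightarrow> tangle k w 0 \<Longrightarrow> no_classical w \<Longrightarrow>
       bracket (u @ PA @ w) = bracket (u @ Virt i # w)"
    "\<And>u k w. tangle 0 u k \<Longrightarrow> i + 1 < k \<Longrightarrow> tangle k w 0 \<Longrightarrow> no_classical w \<Longrightarrow>
       bracket (u @ PB @ w) = bracket (u @ Q @ w)"
proof -
  let ?t = quarter_turn
  note s0 = smooths_modified
  note s1 = smooths_turn[OF s0] note s2 = smooths_turn[OF s1] note s3 = smooths_turn[OF s2]
  note a0 = swap_modified_A
  note a1 = swap_turn[OF a0] note a2 = swap_turn[OF a1] note a3 = swap_turn[OF a2]
  note b0 = hook_modified_B
  note b1 = id_turn[OF b0] note b2 = hook_turn[OF b1] note b3 = id_turn[OF b2]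
  have "modified_crossing d h i \<in> {modified i, ?t modified i, ?t (?t modified) i, ?t (?t (?t modified)) i}"
    unfolding modified_crossing_def Let_def by simp
  then obtain g gA gB where g: "modified_crossing d h i = g i" "smooths g gA gB" "acts_as_swap gA"
    "acts_as_hook gB \<or> acts_as_id gB"
    using s0 s1 s2 s3 a0 a1 a2 a3 b0 b1 b2 b3 by (elim insertE emptyE) blast+
  define Q where "Q = (if acts_as_hook gB then [Cap i, Cup () i] else [] :: diagram)"
  show ?thesis
  proof (rule that[of "gA i" "gB i" Q])
    show "bracket (u @ gB i @ w) = bracket (u @ Q @ w)"
      if "tangle 0 u k" "i + 1 < k" "tangle k w 0" "no_classical w" for u k w
      using bracket_hook[of gB u k i w] bracket_id[of gB u k i w] that g(2,4)
      by (auto simp: Q_def smooths_def)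
    show "bracket (u @ gA i @ w) = bracket (u @ Virt i # w)"
      if "tangle 0 u k" "i + 1 < k" "tangle k w 0" "no_classical w" for u k w
      using bracket_swap[of gA u k i w] that g(2,3) by (auto simp: smooths_def)
  qed (use g(1,2) in \<open>auto simp: Q_def smooths_def\<close>)
qed

section \<open>Invertibility of a crossing by the second Reidemeister move\<close>

lemma A_pow_add: "A_pow a * A_pow b = A_pow (a + b)"
  by (simp add: A_pow_def mult_single)

lemma A_pow_0 [simp]: "A_pow 0 = 1"
  by (simp add: A_pow_def)

lemma bracket_double_hook:
  assumes "tangle 0 u k" "i + 1 < k" "tangle k w 0" "no_classical w"
  shows "bracket (u @ [Cap i, Cup () i] @ [Cap i, Cup () i] @ w) =
    loop_value * bracket (u @ [Cap i, Cup () i] @ w)"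
proof -
  obtain ys a b zs c where w: "denotes w (ys @ [a, b] @ zs) c" "length ys = i" "k = length (ys @ [a, b] @ zs)"
    using assms by (elim denotes_pair)
  obtain e where e: "e \<notin> set (ys @ [a, b] @ zs)" using ex_fresh by blast
  obtain e' where e': "e' \<notin> set (ys @ [a, b, e] @ zs)" using ex_fresh by blast
  let ?ys = "rename b a ys" and ?zs = "rename b a zs" and ?c = "if a = b then c + 1 else c"
  note hook = hook_acts[unfolded acts_as_hook_def, rule_format]
  \<comment> \<open>The single hook is described with two names: with \<open>e\<close> its lower
    ends are closed to a loop by a further hook below, and with \<open>e'\<close> its label list
    agrees with that of the double hook.\<close>
  have 1: "denotes ([Cap i, Cup () i] @ w) (?ys @ [e', e'] @ ?zs) ?c"
    using hook[OF w(1), of e'] w(2) e' by simp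
  have 2: "denotes ([Cap i, Cup () i] @ w) (?ys @ [e, e] @ ?zs) ?c"
    using hook[OF w(1), of e] w(2) e by simp
  have "e \<notin> set ?ys" "e \<notin> set ?zs" "e' \<notin> set (?ys @ [e, e] @ ?zs)" using e e' by auto
  with hook[OF 2, of e'] w(2)
  have "denotes ([Cap i, Cup () i] @ [Cap i, Cup () i] @ w) (?ys @ [e', e'] @ ?zs) (?c + 1)"
    by (simp add: rename_fresh)
  from bracket_transfer[OF _ _ this 1, of u] assms w show ?thesis by simp
qed

text \<open>The vertical smoothing survives with coefficient 1. The hook has coefficient A^2 +
  A^(-2) + \<open>loop_value\<close>, which vanishes: this is the reason for the value of the
  loop.\<close>

lemma bracket_R2:
  assumes "tangle 0 u k" "i + 1 < k" "tangle k w 0" "no_classical w"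
  shows "bracket (u @ Cross_L i # Cross_R i # w) = bracket (u @ w)"
proof -
  let ?h = "[Cap i, Cup () i]"
  let ?x = "bracket (u @ w)" and ?y = "bracket (u @ ?h @ w)"
  have "bracket (u @ Cross_L i # Cross_R i # w) =
      A_pow 1 * bracket ((u @ ?h) @ Cross_R i # w) + A_pow (- 1) * bracket (u @ Cross_R i # w)"
    using bracket_skein(2)[of u i "Cross_R i # w"] by simp
  also have "bracket ((u @ ?h) @ Cross_R i # w) = A_pow 1 * ?y + A_pow (- 1) * (loop_value * ?y)"
    using bracket_skein(1)[of "u @ ?h" i w] bracket_double_hook[OF assms] by simp
  also have "bracket (u @ Cross_R i # w) = A_pow 1 * ?x + A_pow (- 1) * ?y"
    using bracket_skein(1)[of u i w] by simp
  also have "A_pow 1 * (A_pow 1 * ?y + A_pow (- 1) * (loop_value * ?y)) +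
      A_pow (- 1) * (A_pow 1 * ?x + A_pow (- 1) * ?y) =
      (A_pow (- 1) * A_pow 1) * ?x + (A_pow 1 * A_pow 1 + A_pow (- 1) * A_pow (- 1) +
        (A_pow 1 * A_pow (- 1)) * loop_value) * ?y"
    by (simp only: distrib_left distrib_right ac_simps)
  also have "\<dots> = ?x" by (simp add: A_pow_add loop_value_def)
  finally show ?thesis .
qed

section \<open>Crossings and interlaced pairs\<close>

text \<open>For two occurrences of each letter the patterns aabb, abba, baab, bbaa give 4, 2, 2, 0,
  while abab and baba give 3 and 1; only the parity is of interest.\<close>

fun inversions :: "'b \<Rightarrow> 'b \<Rightarrow> 'b list \<Rightarrow> nat" where
  "inversions a b [] = 0"
| "inversions a b (x # xs) = (if x = a then count_list xs b else 0) + inversions a b xs"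

lemma inversions_append:
  "inversions a b (xs @ ys) = inversions a b xs + inversions a b ys + count_list xs a * count_list ys b"
  by (induction xs) (auto simp: algebra_simps)

text \<open>The copies of \<open>x\<close> are adjacent, so each later \<open>b\<close>, or each
  earlier \<open>a\<close>, forms an inversion with both of them or with neither.\<close>

lemma inversions_pair:
  assumes "a \<noteq> b"
  shows "even (inversions a b (ys @ [x, x] @ zs) + inversions a b (ys @ zs))"
proof -
  have "inversions a b (ys @ [x, x] @ zs) = inversions a b (ys @ zs) +
      2 * (of_bool (x = a) * count_list zs b + of_bool (x = b) * count_list ys a)"
    using assms by (auto simp: inversions_append)
  then show ?thesis by simp
qed

text \<open>Exchanging neighbours alters only their own relative order.\<close>

lemma inversions_swap:
  assumes "a \<noteq> b"
  shows "even (inversions a b (ys @ [x, y] @ zs) + inversions a b (ys @ [y, x] @ zs)) \<longleftrightarrow>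
    {x, y} \<noteq> {a, b}"
proof -
  have "inversions a b (ys @ [x, y] @ zs) = inversions a b (ys @ zs) +
      (of_bool (x = a) + of_bool (y = a)) * count_list zs b +
      (of_bool (x = b) + of_bool (y = b)) * count_list ys a + of_bool (x = a \<and> y = b)" for x y
    using assms by (auto simp: inversions_append)
  from this[of x y] this[of y x]
  have "inversions a b (ys @ [x, y] @ zs) + inversions a b (ys @ [y, x] @ zs) =
      2 * (inversions a b (ys @ zs) + (of_bool (x = a) + of_bool (y = a)) * count_list zs b +
      (of_bool (x = b) + of_bool (y = b)) * count_list ys a) +
      (of_bool (x = a \<and> y = b) + of_bool (y = a \<and> x = b))" by simp
  then show ?thesis using assms by (auto simp: doubleton_eq_iff)
qed

definition crossings :: "diagram \<Rightarrow> point set" where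
  "crossings w = {(h, i). virtual_at w h i}"

lemma crossings_Nil [simp]: "crossings [] = {}"
  by (simp add: crossings_def virtual_at_def)

lemma crossings_Cons:
  "crossings (x # w) = {(0, i) | i. x = Virt i} \<union> lift_point 1 ` crossings w"
proof (intro equalityI subsetI)
  fix p assume "p \<in> crossings (x # w)"
  then obtain h i where p: "p = (h, i)" "virtual_at (x # w) h i" by (auto simp: crossings_def)
  show "p \<in> {(0, i) | i. x = Virt i} \<union> lift_point 1 ` crossings w"
  proof (cases h)
    case 0
    then show ?thesis using p by (simp add: virtual_at_def)
  next
    case (Suc h')
    then have "(h', i) \<in> crossings w" using p by (simp add: virtual_at_def crossings_def)
    then have "lift_point 1 (h', i) \<in> lift_point 1 ` crossings w" by (rule imageI)
    then show ?thesis using p Suc by simp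
  qed
qed (auto simp: crossings_def virtual_at_def)

lemma finite_crossings: "finite (crossings w)"
proof (induction w)
  case (Cons x w)
  have "{(0, i) | i. x = Virt i} \<subseteq> (\<lambda>x. case x of Virt i \<Rightarrow> (0, i) | _ \<Rightarrow> (0, 0)) ` {x}"
    by auto
  then have "finite {(0 :: nat, i) | i. x = Virt i}" by (rule finite_subset) simp
  then show ?case using Cons by (simp add: crossings_Cons)
qed simp

fun num_virtual :: "diagram \<Rightarrow> nat" where
  "num_virtual [] = 0"
| "num_virtual (Virt i # w) = Suc (num_virtual w)"
| "num_virtual (x # w) = num_virtual w"

lemma card_crossings: "card (crossings w) = num_virtual w"
proof (induction w)
  case (Cons x w)
  have inj: "card (lift_point 1 ` crossings w) = card (crossings w)"
    by (rule card_image) (simp add: inj_on_def)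
  show ?case
  proof (cases x)
    case (Virt i)
    have "crossings (x # w) = insert (0, i) (lift_point 1 ` crossings w)"
      using Virt by (auto simp: crossings_Cons)
    moreover have "(0, i) \<notin> lift_point 1 ` crossings w" by auto
    ultimately show ?thesis using inj Virt Cons finite_crossings by simp
  qed (use inj Cons in \<open>simp_all add: crossings_Cons\<close>)
qed simp

lemma crossing_in_points:
  assumes "tangle k w l" "(h, i) \<in> crossings w"
  shows "(h, i) \<in> points k w" "(h, i + 1) \<in> points k w"
proof -
  have h: "h < length w" "w ! h = Virt i" using assms(2) by (auto simp: crossings_def virtual_at_def)
  then have "w = take h w @ Virt i # drop (Suc h) w" by (metis id_take_nth_drop)
  then obtain r where "tangle k (take h w) r" "tangle r (Virt i # drop (Suc h) w) l"
    using assms(1) tangle_append by metis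
  then show "(h, i) \<in> points k w" "(h, i + 1) \<in> points k w"
    using h(1) by (auto simp: points_def fold_width_after)
qed

lemma map_upt_split:
  assumes "i + 1 < k"
  shows "map f [0..<k] = map f [0..<i] @ [f i, f (i + 1)] @ map f [i + 2..<k]"
proof -
  have "[0..<k] = [0..<i] @ [i..<k]" using assms upt_add_eq_append[of 0 i "k - i"] by simp
  moreover have "[i..<k] = i # (i + 1) # [i + 2..<k]" using assms by (simp add: upt_conv_Cons)
  ultimately show ?thesis by simp
qed

lemma map_upt_delete:
  assumes "i \<le> k"
  shows "map f [0..<k] = map f [0..<i] @ map f [i..<k]"
  using assms upt_add_eq_append[of 0 i "k - i"] by simp

lemma even_chain: "even (x + y :: nat) \<Longrightarrow> even (y + z) \<Longrightarrow> even (x + z)"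
  by presburger

lemma even_chain_step:
  "even (c + y :: nat) \<Longrightarrow> even (z + y) \<longleftrightarrow> \<not> P \<Longrightarrow> x = (if P then 1 else 0) + c \<Longrightarrow> even (x + z)"
  by (cases P) (simp, presburger)+

text \<open>
  Reading the labels of the strands from left to right at each level, a virtual crossing between an
  \<open>a\<close>-strand and a \<open>b\<close>-strand changes the number of \<open>a\<close>-\<open>b\<close> inversions by one, while all other
  letters preserve its parity.
\<close>

lemma parity_crossings:
  assumes "a \<noteq> b"
  shows "tangle k w 0 \<Longrightarrow> no_classical w \<Longrightarrow>
    (\<And>p q. (p, q) \<in> all_arcs w \<Longrightarrow> p \<in> points k w \<Longrightarrow> F p = F q) \<Longrightarrow>
    even (card {p \<in> crossings w. {F p, F (fst p, snd p + 1)} = {a, b}} +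
      inversions a b (map (\<lambda>j. F (0, j)) [0..<k]))"
proof (induction w arbitrary: k F)
  case Nil
  then show ?case by simp
next
  case (Cons x w)
  \<comment> \<open>\<open>F\<close> has to be arbitrary: above the first letter,
    \<open>arc_ends\<close> of the whole diagram is still constant on arcs, but it is no longer
    \<open>arc_ends\<close> of the remaining word, whose bottom lies one level higher.\<close>
  let ?k = "width_after x k" and ?F = "\<lambda>p. F (lift_point 1 p)"
  let ?X = "\<lambda>F w. {p \<in> crossings w. {F p, F (fst p, snd p + 1)} = {a, b}}"
  let ?as = "map (\<lambda>j. F (0, j)) [0..<k]" and ?bs = "map (\<lambda>j. F (1, j)) [0..<?k]"
  have IH: "even (card (?X ?F w) + inversions a b ?bs)"
  proof -
    have "even (card (?X ?F w) + inversions a b (map (\<lambda>j. ?F (0, j)) [0..<?k]))"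
    proof (rule Cons.IH)
      show "?F p = ?F q" if "(p, q) \<in> all_arcs w" "p \<in> points ?k w" for p q
        using that by (intro Cons.prems(3)) (auto simp: all_arcs_Cons)
      show "no_classical w" using Cons.prems(2) by (cases x) auto
    qed (use Cons.prems(1) in simp)
    then show ?thesis by simp
  qed
  have arc: "F (0, j) = F p" if "((0, j), p) \<in> arcs 0 x" "j < k" for j p
    using that by (intro Cons.prems(3)) (auto simp: all_arcs_Cons)
  have arc1: "F (1, i) = F (1, j)" if "((1, i), (1, j)) \<in> arcs 0 x" "i < ?k" for i j
    using that by (intro Cons.prems(3)) (auto simp: all_arcs_Cons points_def)
  have lifted: "{p \<in> lift_point 1 ` crossings w. {F p, F (fst p, snd p + 1)} = {a, b}} =
      lift_point 1 ` ?X ?F w"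
  proof -
    have "{p \<in> lift_point 1 ` A. P p} = lift_point 1 ` {p \<in> A. P (lift_point 1 p)}" for A P
      by blast
    then show ?thesis by (simp add: lift_point_def)
  qed
  have card_lifted: "card (lift_point 1 ` ?X ?F w) = card (?X ?F w)"
    by (rule card_image) (simp add: inj_on_def)
  have same: "card (?X F (x # w)) = card (?X ?F w)" if "\<And>i. x \<noteq> Virt i"
  proof -
    have "crossings (x # w) = lift_point 1 ` crossings w" using that by (auto simp: crossings_Cons)
    then show ?thesis using lifted card_lifted by simp
  qed
  show ?case
  proof (cases x)
    case (Cup u i)
    then have i: "i \<le> k" using Cons.prems(1) by simp
    let ?ys = "map (\<lambda>j. F (0, j)) [0..<i]" and ?zs = "map (\<lambda>j. F (0, j)) [i..<k]"
    have bs: "?bs = ?ys @ [F (1, i), F (1, i)] @ ?zs"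
    proof -
      have "F (1, i) = F (1, i + 1)" using i Cup by (intro arc1) auto
      moreover have "map (\<lambda>j. F (1, j)) [0..<i] = ?ys"
        using i Cup by (intro map_cong refl arc[symmetric]) auto
      moreover have "map (\<lambda>j. F (1, j)) [i + 2..<k + 2] = ?zs"
      proof (rule nth_equalityI)
        fix j assume "j < length (map (\<lambda>j. F (1, j)) [i + 2..<k + 2])"
        then show "map (\<lambda>j. F (1, j)) [i + 2..<k + 2] ! j = ?zs ! j"
          using Cup arc[of "i + j" "(1, i + j + 2)"] by (simp del: upt_Suc)
      qed (simp del: upt_Suc)
      ultimately show ?thesis using map_upt_split[of i "k + 2" "\<lambda>j. F (1, j)"] i Cup by simp
    qed
    have as: "?as = ?ys @ ?zs" using i by (rule map_upt_delete)
    have "even (inversions a b ?bs + inversions a b ?as)"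
      unfolding as bs by (rule inversions_pair[OF assms])
    moreover have "card (?X F (x # w)) = card (?X ?F w)" by (rule same) (simp add: Cup)
    ultimately show ?thesis using even_chain[OF IH] by simp
  next
    case (Cap i)
    then have i: "i + 1 < k" using Cons.prems(1) by simp
    let ?ys = "map (\<lambda>j. F (1, j)) [0..<i]" and ?zs = "map (\<lambda>j. F (1, j)) [i..<k - 2]"
    have as: "?as = ?ys @ [F (0, i), F (0, i)] @ ?zs"
    proof -
      have "F (0, i) = F (0, i + 1)" using i Cap by (intro arc) auto
      moreover have "map (\<lambda>j. F (0, j)) [0..<i] = ?ys"
        using i Cap by (intro map_cong refl arc) auto
      moreover have "map (\<lambda>j. F (0, j)) [i + 2..<k] = ?zs"
      proof (rule nth_equalityI)
        fix j assume "j < length (map (\<lambda>j. F (0, j)) [i + 2..<k])"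
        then show "map (\<lambda>j. F (0, j)) [i + 2..<k] ! j = ?zs ! j"
          using Cap arc[of "i + j + 2" "(1, i + j)"] by simp
      qed (use i in simp)
      ultimately show ?thesis using map_upt_split[of i k "\<lambda>j. F (0, j)"] i by simp
    qed
    have bs: "?bs = ?ys @ ?zs" unfolding Cap width_after.simps using i by (intro map_upt_delete) simp
    have "even (inversions a b ?bs + inversions a b ?as)"
      unfolding as bs by (subst add.commute) (rule inversions_pair[OF assms])
    moreover have "card (?X F (x # w)) = card (?X ?F w)" by (rule same) (simp add: Cap)
    ultimately show ?thesis using even_chain[OF IH] by simp
  next
    case (Virt i)
    then have i: "i + 1 < k" using Cons.prems(1) by simp
    let ?ys = "map (\<lambda>j. F (0, j)) [0..<i]" and ?zs = "map (\<lambda>j. F (0, j)) [i + 2..<k]"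
    have as: "?as = ?ys @ [F (0, i), F (0, i + 1)] @ ?zs" using i by (rule map_upt_split)
    have bs: "?bs = ?ys @ [F (0, i + 1), F (0, i)] @ ?zs"
    proof -
      have "F (0, i) = F (1, i + 1)" "F (0, i + 1) = F (1, i)" using i Virt by (intro arc; simp)+
      moreover have "map (\<lambda>j. F (1, j)) [0..<i] = ?ys"
        using i Virt by (intro map_cong refl arc[symmetric]) auto
      moreover have "map (\<lambda>j. F (1, j)) [i + 2..<k] = ?zs"
        using i Virt by (intro map_cong refl arc[symmetric]) auto
      ultimately show ?thesis using map_upt_split[of i k "\<lambda>j. F (1, j)"] i Virt by simp
    qed
    have swap: "even (inversions a b ?as + inversions a b ?bs) \<longleftrightarrow> {F (0, i), F (0, i + 1)} \<noteq> {a, b}"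
      unfolding as bs by (rule inversions_swap[OF assms])
    have cr: "crossings (x # w) = insert (0, i) (lift_point 1 ` crossings w)"
      using Virt by (auto simp: crossings_Cons)
    have "?X F (x # w) = (if {F (0, i), F (0, i + 1)} = {a, b} then {(0, i)} else {}) \<union>
        lift_point 1 ` ?X ?F w"
    proof -
      have "{p \<in> insert q Y. P p} = (if P q then {q} else {}) \<union> {p \<in> Y. P p}"
        for q :: point and Y P by auto
      then show ?thesis unfolding cr lifted[symmetric] by simp
    qed
    moreover have "finite (?X ?F w)" by (rule finite_subset[OF _ finite_crossings[of w]]) auto
    moreover have "(0, i) \<notin> lift_point 1 ` ?X ?F w" by auto
    ultimately have "card (?X F (x # w)) =
        (if {F (0, i), F (0, i + 1)} = {a, b} then 1 else 0) + card (?X ?F w)"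
      using card_lifted by (cases "{F (0, i), F (0, i + 1)} = {a, b}") simp_all
    then show ?thesis by (rule even_chain_step[OF IH swap])
  qed (use Cons.prems in auto)
qed

section \<open>Matchings, interlaced pairs and crossing numbers\<close>

definition block :: "nat set set \<Rightarrow> nat \<Rightarrow> nat set" where
  "block m j = (THE e. e \<in> m \<and> j \<in> e)"

lemma block_eq:
  assumes "m \<in> matchings n" "e \<in> m" "j \<in> e"
  shows "block m j = e"
proof -
  have "disjoint m" using assms(1) by (simp add: matchings_def partition_on_def)
  then show ?thesis
    unfolding block_def using assms(2,3) by (intro the_equality) (auto simp: disjoint_def)
qed

lemma matching_nonempty: "m \<in> matchings n \<Longrightarrow> e \<in> m \<Longrightarrow> e \<noteq> {}"
  by (auto simp: matchings_def)

lemma finite_matching: "m \<in> matchings n \<Longrightarrow> finite m"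
  by (auto simp: matchings_def intro: finite_elements)

lemma finite_matchings: "finite (matchings n)"
proof (rule finite_subset)
  show "matchings n \<subseteq> Pow (Pow {0..<2 * n})"
    by (auto simp: matchings_def partition_on_def)
qed simp

text \<open>
  When \<open>e\<close> and \<open>e'\<close> occur twice each, their number of inversions is odd iff they alternate.
\<close>

definition interlaced :: "nat \<Rightarrow> nat set set \<Rightarrow> nat set set set" where
  "interlaced n m = {{e, e'} | e e'. e \<in> m \<and> e' \<in> m \<and> e \<noteq> e' \<and>
     odd (inversions e e' (map (block m) [0..<2 * n]))}"

lemma finite_interlaced:
  assumes "m \<in> matchings n" shows "finite (interlaced n m)"
proof (rule finite_subset)
  show "interlaced n m \<subseteq> Pow m" by (auto simp: interlaced_def)
qed (simp add: finite_matching[OF assms])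

lemma arc_ends_arc: "(p, q) \<in> all_arcs d \<Longrightarrow> arc_ends d p = arc_ends d q"
  unfolding arc_ends_def
  by (meson connected_by_arc connected_by_sym connected_by_trans)

lemma arc_ends_bottom: "j \<in> arc_ends d (0, j)"
  by (simp add: arc_ends_def)

definition strand_pair :: "diagram \<Rightarrow> point \<Rightarrow> nat set set" where
  "strand_pair d p = {arc_ends d p, arc_ends d (fst p, snd p + 1)}"

text \<open>Only the bottom ends are compared with \<open>m\<close>, so the parity count covers
  diagrams with closed curves, self-crossings and repeated crossings as well as drawings.\<close>

lemma parity_strand_pair:
  assumes "tangle (2 * n) d 0" "no_classical d" "\<And>j. j < 2 * n \<Longrightarrow> arc_ends d (0, j) = block m j" "e \<noteq> e'"
  shows "odd (card {p \<in> crossings d. strand_pair d p = {e, e'}}) \<longleftrightarrow>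
    odd (inversions e e' (map (block m) [0..<2 * n]))"
proof -
  have bottom: "map (\<lambda>j. arc_ends d (0, j)) [0..<2 * n] = map (block m) [0..<2 * n]"
    using assms(3) by simp
  have "even (card {p \<in> crossings d. strand_pair d p = {e, e'}} +
      inversions e e' (map (block m) [0..<2 * n]))"
    using parity_crossings[where F = "arc_ends d", OF assms(4,1,2) arc_ends_arc] unfolding strand_pair_def bottom .
  then show ?thesis by simp
qed

lemma drawing_bottom:
  assumes "m \<in> matchings n" "drawing n m d" "j < 2 * n"
  shows "arc_ends d (0, j) = block m j"
proof -
  have "arc_ends d (0, j) \<in> m" using assms(2,3) by (simp add: drawing_def)
  then show ?thesis using block_eq[OF assms(1), of "arc_ends d (0, j)" j] arc_ends_bottom by simp
qed

lemma drawing_no_classical: "drawing n m d \<Longrightarrow> no_classical d"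
  by (simp add: drawing_def no_classical_def)

lemma drawing_tangle: "drawing n m d \<Longrightarrow> tangle (2 * n) d 0"
  by (simp add: drawing_def)

text \<open>In a drawing a pair of arcs that crosses does so exactly once, an odd number of times,
  and is therefore interlaced. As no pair crosses twice, \<open>strand_pair\<close> maps crossings
  injectively to interlaced pairs.\<close>

lemma num_virtual_drawing_le:
  assumes m: "m \<in> matchings n" and d: "drawing n m d"
  shows "num_virtual d \<le> card (interlaced n m)"
proof -
  note t = drawing_tangle[OF d]
  have inj: "p = q" if "p \<in> crossings d" "q \<in> crossings d" "strand_pair d p = strand_pair d q" for p q
  proof -
    obtain h i h' i' where pq: "p = (h, i)" "q = (h', i')" by force
    then have v: "virtual_at d h i" "virtual_at d h' i'" using that by (auto simp: crossings_def)
    then have "h = h'"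
      using d that(3) unfolding pq drawing_def strand_pair_def fst_conv snd_conv by blast
    then show ?thesis using v pq by (simp add: virtual_at_def)
  qed
  have "strand_pair d p \<in> interlaced n m" if p: "p \<in> crossings d" for p
  proof -
    obtain h i where hi: "p = (h, i)" by force
    let ?e = "arc_ends d (h, i)" and ?e' = "arc_ends d (h, i + 1)"
    have e: "?e \<in> m" "?e' \<in> m"
      using crossing_in_points[OF t] p d unfolding hi drawing_def by blast+
    have ne: "?e \<noteq> ?e'" using d p unfolding hi drawing_def crossings_def by blast
    have "{q \<in> crossings d. strand_pair d q = {?e, ?e'}} = {p}"
      using inj[OF _ p] p by (auto simp: strand_pair_def hi)
    then have "odd (inversions ?e ?e' (map (block m) [0..<2 * n]))"
      using parity_strand_pair[OF t drawing_no_classical[OF d] drawing_bottom[OF m d] ne] by simp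
    then show ?thesis using e ne unfolding interlaced_def strand_pair_def hi by auto
  qed
  then have "card (crossings d) \<le> card (interlaced n m)"
    using inj finite_interlaced[OF m] by (intro card_inj_on_le[of "strand_pair d"]) (auto simp: inj_on_def)
  then show ?thesis by (simp add: card_crossings)
qed

text \<open>An interlaced pair crosses an odd number of times, hence at least once, and a crossing
  belongs to one pair only.\<close>

lemma card_interlaced_le:
  assumes "tangle (2 * n) w 0" "no_classical w" "\<And>j. j < 2 * n \<Longrightarrow> arc_ends w (0, j) = block m j"
  shows "card (interlaced n m) \<le> num_virtual w"
proof -
  have "interlaced n m \<subseteq> strand_pair w ` crossings w"
  proof
    fix P assume "P \<in> interlaced n m"
    then obtain e e' where e: "P = {e, e'}" "e \<noteq> e'" "odd (inversions e e' (map (block m) [0..<2 * n]))"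
      unfolding interlaced_def by blast
    then have "odd (card {p \<in> crossings w. strand_pair w p = {e, e'}})"
      using parity_strand_pair[OF assms] by simp
    then have "{p \<in> crossings w. strand_pair w p = {e, e'}} \<noteq> {}" by (metis card.empty even_zero)
    then show "P \<in> strand_pair w ` crossings w" using e(1) by blast
  qed
  then have "card (interlaced n m) \<le> card (strand_pair w ` crossings w)"
    by (intro card_mono) (simp_all add: finite_crossings)
  also have "\<dots> \<le> card (crossings w)" by (rule card_image_le) (rule finite_crossings)
  finally show ?thesis by (simp add: card_crossings)
qed

lemma arc_ends_denoted:
  assumes "denoted_by L w as c" "tangle (length as) w 0" "j < length as"
  shows "arc_ends w (0, j) = {a. a < length as \<and> as ! a = as ! j}"
proof -
  note L = denoted_byD[OF assms(1)]
  have "((0, a), (0, j)) \<in> connected_by (all_arcs w) \<longleftrightarrow> a < length as \<and> as ! a = as ! j" for a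
  proof
    assume *: "((0, a), (0, j)) \<in> connected_by (all_arcs w)"
    have "(0, a) \<in> points (length as) w \<and> L (0, j) = L (0, a)"
      using connected_by_sym[OF *] assms(3) by (intro labelling_connected[OF L(1) assms(2)]) simp_all
    then show "a < length as \<and> as ! a = as ! j" using L(2)[of a] L(2)[of j] assms(3) by simp
  next
    assume "a < length as \<and> as ! a = as ! j"
    then show "((0, a), (0, j)) \<in> connected_by (all_arcs w)"
      using assms(3) by (intro labelled_connected[OF L(1)]) (simp_all add: L(2))
  qed
  then show ?thesis by (simp add: arc_ends_def)
qed

lemma matching_denoted:
  assumes "denotes w as c" "length as = 2 * n"
  shows "(\<lambda>j. arc_ends w (0, j)) ` {..<2 * n} \<in> matchings n"
proof -
  obtain L where L: "denoted_by L w as c" using assms(1) unfolding denotes_def by blast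
  have ends: "arc_ends w (0, j) = {a. a < 2 * n \<and> as ! a = as ! j}" if "j < 2 * n" for j
    using arc_ends_denoted[OF L denotes_tangle[OF assms(1)]] that assms(2) by simp
  have "card (arc_ends w (0, j)) = 2" if "j < 2 * n" for j
  proof -
    have "count_list as (as ! j) = card {a. a < length as \<and> as ! a = as ! j}"
      unfolding count_list_eq_length_filter length_filter_conv_card
      by (rule arg_cong[of _ _ card]) auto
    then show ?thesis using denotes_count[OF assms(1), of "as ! j"] ends[OF that] that assms(2) by simp
  qed
  moreover have "partition_on {0..<2 * n} ((\<lambda>j. arc_ends w (0, j)) ` {..<2 * n})"
  proof (rule partition_onI)
    show "\<Union> ((\<lambda>j. arc_ends w (0, j)) ` {..<2 * n}) = {0..<2 * n}" using ends by auto
  next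
    fix p q assume "p \<in> (\<lambda>j. arc_ends w (0, j)) ` {..<2 * n}" "q \<in> (\<lambda>j. arc_ends w (0, j)) ` {..<2 * n}" "p \<noteq> q"
    then show "disjnt p q" using ends by (auto simp: disjnt_def)
  qed (use ends in auto)
  ultimately show ?thesis by (auto simp: matchings_def)
qed

text \<open>The matching is the one traced by the arcs of \<open>w\<close>, and \<open>c\<close>
  counts its closed curves. A drawing of this matching has the same equality pattern of labels and
  no closed curves, so both glue to \<open>u\<close> alike.\<close>

lemma bracket_virtual_closure:
  assumes "no_classical w" "tangle (2 * n) w 0" "n \<ge> 1"
  shows "\<exists>m\<in>matchings n. card (interlaced n m) \<le> num_virtual w \<and>
    (\<exists>c. \<forall>d u. drawing n m d \<longrightarrow> tangle 0 u (2 * n) \<longrightarrow>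
      bracket (u @ w) = loop_value ^ c * bracket (u @ d))"
proof -
  obtain as c where w: "denotes w as c" "length as = 2 * n" using denotes_exists[OF assms(1,2)] by blast
  obtain L where L: "denoted_by L w as c" using w(1) unfolding denotes_def by blast
  let ?m = "(\<lambda>j. arc_ends w (0, j)) ` {..<2 * n}"
  have m: "?m \<in> matchings n" by (rule matching_denoted[OF w])
  have block: "arc_ends w (0, j) = block ?m j" if "j < 2 * n" for j
    using block_eq[OF m, of "arc_ends w (0, j)" j] that arc_ends_bottom by auto
  show ?thesis
  proof (intro bexI[OF _ m] conjI exI[of _ c] allI impI)
    show "card (interlaced n ?m) \<le> num_virtual w"
      using card_interlaced_le[OF assms(2,1) block] .
  next
    fix d and u :: diagram assume d: "drawing n ?m d" and u: "tangle 0 u (2 * n)"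
    obtain bs c' where d': "denotes d bs c'" "length bs = 2 * n"
      using denotes_exists[OF drawing_no_classical[OF d] drawing_tangle[OF d]] by blast
    obtain M where M: "denoted_by M d bs c'" using d'(1) unfolding denotes_def by blast
    note MD = denoted_byD[OF M]
    \<comment> \<open>A point on a closed curve would reach no bottom end and have empty
      \<open>arc_ends\<close>, which is not a block of a matching.\<close>
    have "M p \<notin> range Inr" if p: "p \<in> points (2 * n) d" for p
    proof -
      have "arc_ends d p \<in> ?m" using d p unfolding drawing_def by blast
      then obtain a where "a \<in> arc_ends d p" using matching_nonempty[OF m] by blast
      then have conn: "(p, (0, a)) \<in> connected_by (all_arcs d)"
        by (simp add: arc_ends_def connected_by_sym)
      have "(0, a) \<in> points (length bs) d \<and> M p = M (0, a)"
        using labelling_connected[OF MD(1) denotes_tangle[OF d'(1)] conn] p d'(2) by simp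
      then show ?thesis using MD(2)[of a] by auto
    qed
    then have "M ` points (length bs) d \<inter> range Inr = {}" using d'(2) by auto
    then have c': "c' = 0" using MD(4) by simp
    have kernel: "as ! i = as ! j \<longleftrightarrow> bs ! i = bs ! j" if "i < length as" "j < length as" for i j
    proof -
      have ij: "i < 2 * n" "j < 2 * n" using that w(2) by simp_all
      have "as ! i = as ! j \<longleftrightarrow> i \<in> arc_ends w (0, j)"
        using arc_ends_denoted[OF L denotes_tangle[OF w(1)]] that by simp
      also have "arc_ends w (0, j) = arc_ends d (0, j)"
        using block[OF ij(2)] drawing_bottom[OF m d ij(2)] by simp
      also have "i \<in> arc_ends d (0, j) \<longleftrightarrow> bs ! i = bs ! j"
        using arc_ends_denoted[OF M denotes_tangle[OF d'(1)]] ij d'(2) by simp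
      finally show ?thesis .
    qed
    show "bracket (u @ w) = loop_value ^ c * bracket (u @ d)"
      using bracket_transfer[of w d as 0 c bs u] assms drawing_no_classical[OF d] w d' c' kernel u
      by fastforce
  qed
qed

section \<open>Linear combinations of closures\<close>

text \<open>A formal combination of exteriors, kept as a list so that terms and coefficients are
  fixed before the lower word is given.\<close>

definition combination :: "(laurent \<times> diagram) list \<Rightarrow> diagram \<Rightarrow> laurent" where
  "combination cs u = (\<Sum>(c, w)\<leftarrow>cs. c * bracket (u @ w))"

lemma combination_simps [simp]:
  "combination [] u = 0"
  "combination ((c, w) # cs) u = c * bracket (u @ w) + combination cs u"
  "combination (cs @ cs') u = combination cs u + combination cs' u"
  by (simp_all add: combination_def)

definition shift_combination :: "laurent \<Rightarrow> diagram \<Rightarrow> (laurent \<times> diagram) list \<Rightarrow> (laurent \<times> diagram) list" where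
  "shift_combination a p cs = map (\<lambda>(c, w). (a * c, p @ w)) cs"

lemma combination_shift: "combination (shift_combination a p cs) u = a * combination cs (u @ p)"
  by (induction cs) (auto simp: shift_combination_def distrib_left mult.assoc)

lemma set_shift_combination:
  "(c, w) \<in> set (shift_combination a p cs) \<longleftrightarrow> (\<exists>c' w'. (c', w') \<in> set cs \<and> c = a * c' \<and> w = p @ w')"
  by (force simp: shift_combination_def)

lemma combination_cong:
  "(\<And>c w. (c, w) \<in> set cs \<Longrightarrow> bracket (u @ w) = bracket (u' @ w)) \<Longrightarrow>
    combination cs u = combination cs u'"
proof (induction cs)
  case (Cons x cs)
  obtain c w where x: "x = (c, w)" by force
  have "combination cs u = combination cs u'" using Cons.prems by (intro Cons.IH) force
  then show ?case using Cons.prems[of c w] x by simp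
qed simp

lemma tangle_hook_Cons:
  assumes "i + 1 < k"
  shows "tangle k (Cap i # Cup () i # w) l \<longleftrightarrow> tangle k w l"
proof -
  have "i \<le> k - 2" "Suc (Suc (k - 2)) = k" using assms by simp_all
  then show ?thesis using assms by simp
qed

text \<open>A crossing turns the expansion of the rest into two scaled copies, one of them with a
  hook in front; any other letter is put in front of every term. The skein relation is uniform in
  \<open>u\<close>, and so is the list.\<close>

lemma classical_expansion:
  "tangle k w 0 \<Longrightarrow> \<exists>cs. (\<forall>(c, w')\<in>set cs. tangle k w' 0 \<and> no_classical w') \<and>
    (\<forall>u. bracket (u @ w) = combination cs u)"
proof (induction w arbitrary: k)
  case Nil
  then show ?case by (intro exI[of _ "[(1, [])]"]) simp
next
  case (Cons x w)
  obtain cs where cs: "\<forall>(c, w')\<in>set cs. tangle (width_after x k) w' 0 \<and> no_classical w'"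
    "\<And>u. bracket (u @ w) = combination cs u"
    using Cons.IH[of "width_after x k"] Cons.prems by auto
  have x: "admissible k x" using Cons.prems by simp
  have noncrossing: ?case if "no_classical [x]"
  proof (intro exI[of _ "shift_combination 1 [x] cs"] conjI allI)
    have "tangle k ([x] @ w') 0 \<and> no_classical ([x] @ w')" if "(c, w') \<in> set cs" for c w'
      using cs(1) x \<open>no_classical [x]\<close> that unfolding no_classical_append by auto
    then show "\<forall>(c, w')\<in>set (shift_combination 1 [x] cs). tangle k w' 0 \<and> no_classical w'"
      by (auto simp: set_shift_combination)
    show "bracket (u @ x # w) = combination (shift_combination 1 [x] cs) u" for u
      using cs(2)[of "u @ [x]"] by (simp add: combination_shift)
  qed
  have crossing: ?case if "\<And>u. bracket (u @ x # w) = a * bracket (u @ w) + b * bracket ((u @ [Cap i, Cup () i]) @ w)"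
    "width_after x k = k" "i + 1 < k" for a b i
  proof (intro exI[of _ "shift_combination a [] cs @ shift_combination b [Cap i, Cup () i] cs"] conjI allI)
    have "tangle k w' 0 \<and> no_classical w' \<and> tangle k ([Cap i, Cup () i] @ w') 0 \<and>
        no_classical ([Cap i, Cup () i] @ w')" if "(c, w') \<in> set cs" for c w'
      using cs(1) \<open>width_after x k = k\<close> tangle_hook_Cons[OF \<open>i + 1 < k\<close>] that by auto
    then show "\<forall>(c, w')\<in>set (shift_combination a [] cs @ shift_combination b [Cap i, Cup () i] cs).
        tangle k w' 0 \<and> no_classical w'"
      by (auto simp: set_shift_combination)
    show "bracket (u @ x # w) = combination (shift_combination a [] cs @ shift_combination b [Cap i, Cup () i] cs) u" for u
      using cs(2)[of u] cs(2)[of "u @ [Cap i, Cup () i]"] that(1)[of u] by (simp add: combination_shift)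
  qed
  show ?case
  proof (cases x)
    case (Cross_R i)
    show ?thesis
      using crossing[of "A_pow 1" "A_pow (- 1)" i] bracket_skein(1)[of _ i w] Cross_R x by simp
  next
    case (Cross_L i)
    show ?thesis
      using crossing[of "A_pow (- 1)" "A_pow 1" i] bracket_skein(2)[of _ i w] Cross_L x
      by (simp add: add.commute)
  qed (rule noncrossing, simp)+
qed

text \<open>Choosing the first smoothing everywhere gives back \<open>d\<close>, with one factor A
  per crossing; every other choice loses a virtual crossing. \<open>M\<close> is generalised because
  \<open>modified_crossing d\<close> refers to the complete diagram, which is no longer at hand in
  the induction.\<close>

lemma modified_expansion:
  assumes "tangle k d 0" "no_classical d"
    and "\<And>h i. \<exists>d' h'. M h i = modified_crossing d' h' i"
  shows "\<exists>cs. (\<forall>(c, w)\<in>set cs. tangle k w 0 \<and> no_classical w \<and> num_virtual w < num_virtual d) \<and>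
    (\<forall>u. tangle 0 u k \<longrightarrow>
      bracket (u @ concat (map (\<lambda>h. case d ! h of Virt i \<Rightarrow> M h i | x \<Rightarrow> [x]) [0..<length d])) =
      A_pow (int (num_virtual d)) * bracket (u @ d) + combination cs u)"
  using assms
proof (induction d arbitrary: k M)
  case Nil
  then show ?case by (intro exI[of _ "[]"]) simp
next
  case (Cons x d)
  let ?g = "\<lambda>M d h. case d ! h of Virt i \<Rightarrow> M h i | x \<Rightarrow> [x]"
  let ?M = "\<lambda>h. M (Suc h)" and ?k = "width_after x k"
  let ?W = "concat (map (?g ?M d) [0..<length d])"
  have e: "concat (map (?g M (x # d)) [0..<length (x # d)]) = ?g M (x # d) 0 @ ?W"
    by (simp add: upt_conv_Cons map_Suc_upt[symmetric] o_def del: upt_Suc)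
  have nc: "no_classical d" using Cons.prems(2) by (cases x) auto
  have x: "admissible k x" and td: "tangle ?k d 0" using Cons.prems(1) by simp_all
  obtain cs where cs: "\<forall>(c, w)\<in>set cs. tangle ?k w 0 \<and> no_classical w \<and> num_virtual w < num_virtual d"
    and W: "\<And>u. tangle 0 u ?k \<Longrightarrow> bracket (u @ ?W) = A_pow (int (num_virtual d)) * bracket (u @ d) + combination cs u"
    using Cons.IH[OF td nc, of ?M] Cons.prems(3) by blast
  show ?case
  proof (cases "\<exists>i. x = Virt i")
    case True
    then obtain i where i: "x = Virt i" by blast
    then have ik: "i + 1 < k" and k: "?k = k" using x by simp_all
    obtain d' h' where M0: "M 0 i = modified_crossing d' h' i" using Cons.prems(3) by blast
    obtain PA PB Q where P:
      "\<And>u w. bracket (u @ M 0 i @ w) =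
         A_pow 1 * bracket (u @ PA @ w) + A_pow (- 1) * bracket (u @ PB @ w)"
      "\<And>k. i + 1 < k \<Longrightarrow> tangle k PA k" "\<And>k. i + 1 < k \<Longrightarrow> tangle k PB k"
      "Q = [] \<or> Q = [Cap i, Cup () i]"
      "\<And>u k w. tangle 0 u k \<Longrightarrow> i + 1 < k \<Longrightarrow> tangle k w 0 \<Longrightarrow> no_classical w \<Longrightarrow>
         bracket (u @ PA @ w) = bracket (u @ Virt i # w)"
      "\<And>u k w. tangle 0 u k \<Longrightarrow> i + 1 < k \<Longrightarrow> tangle k w 0 \<Longrightarrow> no_classical w \<Longrightarrow>
         bracket (u @ PB @ w) = bracket (u @ Q @ w)"
      unfolding M0 by (rule modified_crossing_smooths[of d' h' i]) blast
    let ?N = "A_pow (int (num_virtual d))"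
    \<comment> \<open>The three sources of the remainder: the remainder of the upper part behind a
      kept crossing, the leading term with this crossing lost, and the remainder behind a lost
      crossing.\<close>
    let ?cs = "shift_combination (A_pow 1) [Virt i] cs @
      (A_pow (- 1) * ?N, Q @ d) # shift_combination (A_pow (- 1)) Q cs"
    have Q: "tangle k (Q @ w) 0" "no_classical (Q @ w) \<longleftrightarrow> no_classical w" "num_virtual (Q @ w) = num_virtual w"
      if "tangle k w 0" for w
      using P(4) that tangle_hook_Cons[OF ik] by auto
    show ?thesis
    proof (intro exI[of _ ?cs] conjI allI impI)
      show "\<forall>(c, w)\<in>set ?cs. tangle k w 0 \<and> no_classical w \<and> num_virtual w < num_virtual (x # d)"
      proof (intro ballI, clarify)
        fix c w assume "(c, w) \<in> set ?cs"
        then consider c' w' where "(c', w') \<in> set cs" "w = Virt i # w'" | "w = Q @ d"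
          | c' w' where "(c', w') \<in> set cs" "w = Q @ w'"
          by (auto simp: set_shift_combination)
        then show "tangle k w 0 \<and> no_classical w \<and> num_virtual w < num_virtual (x # d)"
        proof cases
          case 1
          then show ?thesis using cs ik k i by fastforce
        next
          case 2
          then show ?thesis using Q[of d] td nc k i by simp
        next
          case (3 c' w')
          then have "tangle k w' 0" "no_classical w'" "num_virtual w' < num_virtual d"
            using cs k by auto
          then show ?thesis using Q[of w'] 3 i by simp
        qed
      qed
    next
      fix u :: diagram assume u: "tangle 0 u k"
      \<comment> \<open>The word \<open>?W\<close> still contains classical crossings, so
        \<open>PA\<close> cannot be replaced in front of it. It is expanded first, and the
        replacement is then made in every term.\<close>
      have A: "bracket ((u @ PA) @ ?W) = ?N * bracket ((u @ [Virt i]) @ d) + combination cs (u @ [Virt i])"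
      proof -
        have "bracket ((u @ PA) @ ?W) = ?N * bracket ((u @ PA) @ d) + combination cs (u @ PA)"
          using u P(2)[OF ik] k by (intro W) (auto simp: tangle_append)
        moreover have "combination cs (u @ PA) = combination cs (u @ [Virt i])"
          using cs P(5)[OF u ik] k by (intro combination_cong) fastforce
        ultimately show ?thesis using P(5)[OF u ik _ nc] td k by simp
      qed
      have B: "bracket ((u @ PB) @ ?W) = ?N * bracket (u @ Q @ d) + combination cs (u @ Q)"
      proof -
        have "bracket ((u @ PB) @ ?W) = ?N * bracket ((u @ PB) @ d) + combination cs (u @ PB)"
          using u P(3)[OF ik] k by (intro W) (auto simp: tangle_append)
        moreover have "combination cs (u @ PB) = combination cs (u @ Q)"
          using cs P(6)[OF u ik] k by (intro combination_cong) fastforce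
        ultimately show ?thesis using P(6)[OF u ik _ nc] td k by simp
      qed
      have "bracket (u @ concat (map (?g M (x # d)) [0..<length (x # d)])) =
          A_pow 1 * bracket ((u @ PA) @ ?W) + A_pow (- 1) * bracket ((u @ PB) @ ?W)"
        unfolding e using P(1)[of u ?W] i by simp
      also have "\<dots> = (A_pow 1 * ?N) * bracket (u @ x # d) + combination ?cs u"
        unfolding A B using i by (simp add: combination_shift distrib_left ac_simps)
      also have "A_pow 1 * ?N = A_pow (int (num_virtual (x # d)))" using i by (simp add: A_pow_add)
      finally show "bracket (u @ concat (map (?g M (x # d)) [0..<length (x # d)])) =
          A_pow (int (num_virtual (x # d))) * bracket (u @ x # d) + combination ?cs u" .
    qed
  next
    case False
    then have x1: "?g M (x # d) 0 = [x]" "num_virtual (x # w) = num_virtual w" for w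
      by (cases x; simp)+
    have ncx: "no_classical (x # w) \<longleftrightarrow> no_classical w" for w
      using Cons.prems(2) by (cases x) auto
    show ?thesis
    proof (intro exI[of _ "shift_combination 1 [x] cs"] conjI allI impI)
      show "\<forall>(c, w)\<in>set (shift_combination 1 [x] cs).
          tangle k w 0 \<and> no_classical w \<and> num_virtual w < num_virtual (x # d)"
        using cs x x1(2) ncx by (fastforce simp: set_shift_combination)
    next
      fix u :: diagram assume u: "tangle 0 u k"
      then have "tangle 0 (u @ [x]) ?k" using x by (auto simp: tangle_append)
      from W[OF this]
      show "bracket (u @ concat (map (?g M (x # d)) [0..<length (x # d)])) =
          A_pow (int (num_virtual (x # d))) * bracket (u @ x # d) +
          combination (shift_combination 1 [x] cs) u"
        unfolding e x1 by (simp add: combination_shift)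
    qed
  qed
qed

section \<open>Functions of the lower word spanned by closures\<close>

definition spanned :: "nat \<Rightarrow> (nat set set \<Rightarrow> diagram) \<Rightarrow> (diagram \<Rightarrow> laurent) \<Rightarrow> bool" where
  "spanned n g \<phi> \<longleftrightarrow> (\<exists>q. \<forall>u. tangle 0 u (2 * n) \<longrightarrow>
     \<phi> u = (\<Sum>m\<in>matchings n. q m * bracket (u @ g m)))"

lemma spanned_0: "spanned n g (\<lambda>_. 0)"
  unfolding spanned_def by (intro exI[of _ "\<lambda>_. 0"]) simp

lemma spanned_add:
  assumes "spanned n g \<phi>" "spanned n g \<psi>" shows "spanned n g (\<lambda>u. \<phi> u + \<psi> u)"
proof -
  obtain p q where "\<And>u. tangle 0 u (2 * n) \<Longrightarrow> \<phi> u = (\<Sum>m\<in>matchings n. p m * bracket (u @ g m))"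
    "\<And>u. tangle 0 u (2 * n) \<Longrightarrow> \<psi> u = (\<Sum>m\<in>matchings n. q m * bracket (u @ g m))"
    using assms unfolding spanned_def by blast
  then show ?thesis unfolding spanned_def
    by (intro exI[of _ "\<lambda>m. p m + q m"]) (simp add: distrib_right sum.distrib)
qed

lemma spanned_mult:
  assumes "spanned n g \<phi>" shows "spanned n g (\<lambda>u. a * \<phi> u)"
proof -
  obtain p where "\<And>u. tangle 0 u (2 * n) \<Longrightarrow> \<phi> u = (\<Sum>m\<in>matchings n. p m * bracket (u @ g m))"
    using assms unfolding spanned_def by blast
  then show ?thesis unfolding spanned_def
    by (intro exI[of _ "\<lambda>m. a * p m"]) (simp add: sum_distrib_left mult.assoc)
qed

lemma spanned_base:
  assumes "m \<in> matchings n" shows "spanned n g (\<lambda>u. bracket (u @ g m))"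
  unfolding spanned_def
proof (intro exI[of _ "\<lambda>m'. if m' = m then 1 else 0"] allI impI)
  fix u :: diagram
  have "(\<Sum>m'\<in>matchings n. (if m' = m then 1 else 0) * bracket (u @ g m')) =
      (\<Sum>m'\<in>matchings n. if m' = m then bracket (u @ g m') else 0)"
    by (rule sum.cong) auto
  then show "bracket (u @ g m) = (\<Sum>m'\<in>matchings n. (if m' = m then 1 else 0) * bracket (u @ g m'))"
    using assms finite_matchings[of n] by simp
qed

lemma spanned_cong:
  "(\<And>u. tangle 0 u (2 * n) \<Longrightarrow> \<phi> u = \<psi> u) \<Longrightarrow> spanned n g \<psi> \<Longrightarrow> spanned n g \<phi>"
  unfolding spanned_def by auto

lemma spanned_combination:
  "(\<And>c w. (c, w) \<in> set cs \<Longrightarrow> spanned n g (\<lambda>u. bracket (u @ w))) \<Longrightarrow> spanned n g (combination cs)"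
proof (induction cs)
  case Nil
  then show ?case by (simp add: spanned_0 spanned_cong)
next
  case (Cons x cs)
  obtain c w where x: "x = (c, w)" by force
  then have "spanned n g (\<lambda>u. c * bracket (u @ w))" using Cons.prems[of c w] by (intro spanned_mult) simp
  moreover have "spanned n g (combination cs)" using Cons.prems by (intro Cons.IH) force
  ultimately have "spanned n g (\<lambda>u. c * bracket (u @ w) + combination cs u)" by (rule spanned_add)
  then show ?case by (rule spanned_cong[rotated]) (simp add: x)
qed

text \<open>The two crossing bounds turn the loss of a virtual crossing in the remainder into the
  loss of an interlaced pair of the matching, so the induction hypothesis applies to every remainder
  term.\<close>

lemma spanned_drawing:
  assumes "n \<ge> 1" and d: "\<And>m. m \<in> matchings n \<Longrightarrow> drawing n m (d m)"
  shows "m \<in> matchings n \<Longrightarrow> spanned n (\<lambda>m. modify (d m)) (\<lambda>u. bracket (u @ d m))"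
proof (induction "card (interlaced n m)" arbitrary: m rule: less_induct)
  case less
  let ?g = "\<lambda>m. modify (d m)"
  let ?N = "int (num_virtual (d m))"
  have dm: "drawing n m (d m)" using d less.prems .
  obtain cs where cs: "\<forall>(c, w)\<in>set cs. tangle (2 * n) w 0 \<and> no_classical w \<and> num_virtual w < num_virtual (d m)"
    and exp: "\<And>u. tangle 0 u (2 * n) \<Longrightarrow>
      bracket (u @ ?g m) = A_pow ?N * bracket (u @ d m) + combination cs u"
    using modified_expansion[OF drawing_tangle[OF dm] drawing_no_classical[OF dm], of "modified_crossing (d m)"]
    unfolding modify_def by blast
  have "spanned n ?g (\<lambda>u. bracket (u @ w))" if "(c, w) \<in> set cs" for c w
  proof -
    have w: "no_classical w" "tangle (2 * n) w 0" "num_virtual w < num_virtual (d m)"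
      using cs that by auto
    obtain m' c' where m': "m' \<in> matchings n" "card (interlaced n m') \<le> num_virtual w"
      "\<forall>d u. drawing n m' d \<longrightarrow> tangle 0 u (2 * n) \<longrightarrow> bracket (u @ w) = loop_value ^ c' * bracket (u @ d)"
      using bracket_virtual_closure[OF w(1,2) assms(1)] by blast
    have "card (interlaced n m') < card (interlaced n m)"
      using m'(2) w(3) num_virtual_drawing_le[OF less.prems dm] by linarith
    then have "spanned n ?g (\<lambda>u. loop_value ^ c' * bracket (u @ d m'))"
      using less.hyps m'(1) by (intro spanned_mult) blast
    then show ?thesis by (rule spanned_cong[rotated]) (use m'(3) d[OF m'(1)] in blast)
  qed
  \<comment> \<open>The expansion is solved for the drawing, which is possible since its coefficient
    is a power of A and thus a unit.\<close>
  then have "spanned n ?g (\<lambda>u. A_pow (- ?N) * (bracket (u @ ?g m) + (- 1) * combination cs u))"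
    by (intro spanned_mult spanned_add spanned_base less.prems spanned_combination)
  then show ?case
  proof (rule spanned_cong[rotated])
    fix u :: diagram assume "tangle 0 u (2 * n)"
    then show "bracket (u @ d m) = A_pow (- ?N) * (bracket (u @ ?g m) + (- 1) * combination cs u)"
      by (simp add: exp mult.assoc[symmetric] A_pow_add)
  qed
qed

lemma spanned_virtual:
  assumes "n \<ge> 1" and d: "\<And>m. m \<in> matchings n \<Longrightarrow> drawing n m (d m)"
    and w: "no_classical w" "tangle (2 * n) w 0"
  shows "spanned n (\<lambda>m. modify (d m)) (\<lambda>u. bracket (u @ w))"
proof -
  obtain m c where m: "m \<in> matchings n"
    "\<forall>d u. drawing n m d \<longrightarrow> tangle 0 u (2 * n) \<longrightarrow> bracket (u @ w) = loop_value ^ c * bracket (u @ d)"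
    using bracket_virtual_closure[OF w assms(1)] by blast
  have "spanned n (\<lambda>m. modify (d m)) (\<lambda>u. loop_value ^ c * bracket (u @ d m))"
    by (intro spanned_mult spanned_drawing assms(1) d m(1))
  then show ?thesis by (rule spanned_cong[rotated]) (use m(2) d[OF m(1)] in blast)
qed

text \<open>To create the first braid letter, \<open>Cross_L i # Cross_R i\<close> is inserted below
  \<open>w\<close>. Smoothing only the \<open>Cross_R i\<close> leaves two exteriors without
  classical crossings, which are spanned by closures through the shorter braid.\<close>

lemma spanned_braid:
  assumes "\<And>w. no_classical w \<Longrightarrow> tangle (2 * n) w 0 \<Longrightarrow> spanned n g (\<lambda>u. bracket (u @ w))"
  shows "\<forall>i\<in>set js. i + 1 < 2 * n \<Longrightarrow> no_classical w \<Longrightarrow> tangle (2 * n) w 0 \<Longrightarrow>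
    spanned n (\<lambda>m. map Cross_L js @ g m) (\<lambda>u. bracket (u @ w))"
proof (induction js arbitrary: w)
  case Nil
  then show ?case using assms by simp
next
  case (Cons i js)
  let ?g = "\<lambda>m. map Cross_L js @ g m" and ?h = "[Cap i, Cup () i]"
  have i: "i + 1 < 2 * n" using Cons.prems by simp
  have "spanned n ?g (\<lambda>u. bracket (u @ w))" "spanned n ?g (\<lambda>u. bracket (u @ ?h @ w))"
    using Cons.prems tangle_hook_Cons[OF i] by (auto intro!: Cons.IH simp del: tangle.simps)
  then have "spanned n ?g (\<lambda>u. A_pow 1 * bracket (u @ w) + A_pow (- 1) * bracket (u @ ?h @ w))"
    by (intro spanned_add spanned_mult)
  then obtain q where q: "\<And>u. tangle 0 u (2 * n) \<Longrightarrow>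
      A_pow 1 * bracket (u @ w) + A_pow (- 1) * bracket (u @ ?h @ w) =
      (\<Sum>m\<in>matchings n. q m * bracket (u @ ?g m))"
    unfolding spanned_def by blast
  show ?case
    unfolding spanned_def
  proof (intro exI[of _ q] allI impI)
    fix u :: diagram assume u: "tangle 0 u (2 * n)"
    then have u': "tangle 0 (u @ [Cross_L i]) (2 * n)" using i by (auto simp: tangle_append)
    have "bracket (u @ w) = bracket ((u @ [Cross_L i]) @ Cross_R i # w)"
      using bracket_R2[OF u i Cons.prems(3,2)] by simp
    also have "\<dots> = A_pow 1 * bracket ((u @ [Cross_L i]) @ w) +
        A_pow (- 1) * bracket ((u @ [Cross_L i]) @ ?h @ w)"
      by (rule bracket_skein(1))
    \<comment> \<open>The identity for the shorter braid is used with \<open>u @ [Cross_L i]\<close>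
      as lower word; the same \<open>q\<close> therefore works for the longer one.\<close>
    also have "\<dots> = (\<Sum>m\<in>matchings n. q m * bracket ((u @ [Cross_L i]) @ ?g m))" by (rule q[OF u'])
    finally show "bracket (u @ w) = (\<Sum>m\<in>matchings n. q m * bracket (u @ map Cross_L (i # js) @ g m))"
      by simp
  qed
qed

section \<open>Orientations, writhe and the passage to the auxiliary polynomial\<close>

lemma oriented_tangle_forget:
  "oriented_tangle v w v' \<Longrightarrow> tangle (length v) (forget w) (length v')"
proof (induction w arbitrary: v)
  case Nil
  then show ?case by (simp add: forget_def)
next
  case (Cons x w)
  have "length (orient_after x v) = width_after (map_letter (\<lambda>_. ()) x) (length v)"
    "admissible (length v) (map_letter (\<lambda>_. ()) x)"
    using Cons.prems by (cases x; simp)+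
  then show ?case using Cons.IH[of "orient_after x v"] Cons.prems by (simp add: forget_def)
qed

lemma forget_append: "forget (u @ w) = forget u @ forget w"
  by (simp add: forget_def)

lemma orientation_braid_Cross_L: "\<exists>js. orientation_braid v = map Cross_L js"
proof (induction v rule: orientation_braid.induct)
  case (1 v)
  let ?p = "alt_len v"
  let ?P = "\<lambda>j. ?p < j \<and> j < length v \<and> v ! j \<noteq> v ! ?p"
  show ?case
  proof (cases "\<exists>j. ?P j")
    case True
    define j where "j = (LEAST j. ?P j)"
    obtain js where "orientation_braid (move_entry ?p j v) = map Cross_L js"
      using 1[OF refl j_def True] by blast
    then have "orientation_braid v = map Cross_L (rev [?p..<j] @ js)"
      unfolding j_def using True by (subst orientation_braid.simps) (simp add: Let_def)
    then show ?thesis by blast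
  next
    case False
    then have "orientation_braid v = map Cross_L []"
      by (subst orientation_braid.simps) (simp only: Let_def if_False list.map)
    then show ?thesis by blast
  qed
qed

lemma Cross_L_positions: "tangle k (map Cross_L js) l \<Longrightarrow> \<forall>i\<in>set js. i + 1 < k"
  by (induction js) auto

lemma writhe_from_append:
  "oriented_tangle v w v' \<Longrightarrow> writhe_from v (w @ w') = writhe_from v w + writhe_from v' w'"
  by (induction w arbitrary: v) auto

text \<open>This is -A^3 raised to the power \<open>- k\<close>, a homomorphism from the integers to
  the units.\<close>

definition writhe_factor :: "int \<Rightarrow> laurent" where
  "writhe_factor k = Poly_Mapping.single (- 3 * k) (if even k then 1 else - 1)"

lemma writhe_factor_add: "writhe_factor (a + b) = writhe_factor a * writhe_factor b"
  by (simp add: writhe_factor_def mult_single algebra_simps)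

lemma writhe_factor_inverse: "writhe_factor a * writhe_factor (- a) = 1"
  unfolding writhe_factor_add[symmetric] by (simp add: writhe_factor_def)

lemma aux_poly_factor: "aux_poly w = writhe_factor (writhe w) * bracket (forget w)"
  by (simp add: aux_poly_def writhe_factor_def)

theorem theorem2p3:
  fixes n :: nat and v :: "bool list" and T' :: oriented_diagram
    and d :: "nat set set \<Rightarrow> diagram" and E :: "nat set set \<Rightarrow> oriented_diagram"
  assumes "n \<ge> 1"
    and "length v = 2 * n" and "count_list v True = n"
    and "oriented_tangle v T' []"
    and "\<And>m. m \<in> matchings n \<Longrightarrow> drawing n m (d m)"
    and "\<And>m. m \<in> matchings n \<Longrightarrow> oriented_exterior n (d m) (E m)"
  shows "\<exists>q :: nat set set \<Rightarrow> laurent. \<forall>T. oriented_tangle [] T v \<longrightarrow>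
    aux_poly (T @ T') = (\<Sum>m\<in>matchings n. q m * aux_poly (modified_closure T v (E m)))"
proof -
  let ?b = "orientation_braid v"
  obtain js where js: "?b = map Cross_L js" using orientation_braid_Cross_L by blast
  have fb: "forget ?b = map Cross_L js" by (simp add: js forget_def)
  have pos: "\<forall>i\<in>set js. i + 1 < 2 * n"
    using oriented_tangle_forget[OF oriented_tangle_braid[OF assms(2,3)]] assms(2) fb
    by (intro Cross_L_positions[of _ _ "length (standard n)"]) simp
  have T': "tangle (2 * n) (forget T') 0" using oriented_tangle_forget[OF assms(4)] assms(2) by simp
  let ?g = "\<lambda>m. map Cross_L js @ modify (d m)"
  obtain cs where cs: "\<forall>(c, w)\<in>set cs. tangle (2 * n) w 0 \<and> no_classical w"
    "\<And>u. bracket (u @ forget T') = combination cs u"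
    using classical_expansion[OF T'] by blast
  have "spanned n ?g (combination cs)"
  proof (rule spanned_combination)
    fix c w assume "(c, w) \<in> set cs"
    then have "no_classical w" "tangle (2 * n) w 0" using cs(1) by auto
    then show "spanned n ?g (\<lambda>u. bracket (u @ w))"
      using spanned_braid[where g = "\<lambda>m. modify (d m)", OF spanned_virtual[OF assms(1,5)] pos] by blast
  qed
  then obtain q where q: "\<And>u. tangle 0 u (2 * n) \<Longrightarrow>
      bracket (u @ forget T') = (\<Sum>m\<in>matchings n. q m * bracket (u @ ?g m))"
    unfolding spanned_def cs(2) by blast
  \<comment> \<open>The writhe of all that is glued onto \<open>T\<close>. The directions
    \<open>v\<close> at the interface determine it, so it does not involve \<open>T\<close>.\<close>
  let ?s = "\<lambda>m. writhe_from v (?b @ E m)"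
  \<comment> \<open>Both sides contain the factor for the writhe of \<open>T\<close>. What remains
    is to supply the factor of \<open>T'\<close> and to cancel that of the braid and the
    exterior.\<close>
  let ?q = "\<lambda>m. q m * (writhe_factor (writhe_from v T') * writhe_factor (- ?s m))"
  show ?thesis
  proof (intro exI[of _ ?q] allI impI)
    fix T assume T: "oriented_tangle [] T v"
    have tT: "tangle 0 (forget T) (2 * n)" using oriented_tangle_forget[OF T] assms(2) by simp
    let ?t = "writhe_factor (writhe T)" and ?t' = "writhe_factor (writhe_from v T')"
    have writhe: "writhe (T @ w) = writhe T + writhe_from v w" for w
      using writhe_from_append[OF T] by (simp add: writhe_def)
    have "aux_poly (T @ T') = ?t * ?t' * (\<Sum>m\<in>matchings n. q m * bracket (forget T @ ?g m))"
      unfolding aux_poly_factor forget_append writhe writhe_factor_add q[OF tT] ..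
    also have "\<dots> = (\<Sum>m\<in>matchings n. ?t * ?t' * (q m * bracket (forget T @ ?g m)))"
      by (rule sum_distrib_left)
    also have "\<dots> = (\<Sum>m\<in>matchings n. ?q m * aux_poly (modified_closure T v (E m)))"
    proof (rule sum.cong[OF refl])
      fix m assume m: "m \<in> matchings n"
      have "forget (E m) = modify (d m)" using assms(6)[OF m] by (simp add: oriented_exterior_def)
      then have "aux_poly (modified_closure T v (E m)) =
          ?t * writhe_factor (?s m) * bracket (forget T @ ?g m)"
        by (simp add: modified_closure_def aux_poly_factor forget_append writhe writhe_factor_add fb)
      then have "?q m * aux_poly (modified_closure T v (E m)) =
          (writhe_factor (?s m) * writhe_factor (- ?s m)) * (?t * ?t' * (q m * bracket (forget T @ ?g m)))"
        by (simp only: ac_simps)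
      then show "?t * ?t' * (q m * bracket (forget T @ ?g m)) =
          ?q m * aux_poly (modified_closure T v (E m))"
        by (simp only: writhe_factor_inverse mult_1)
    qed
    finally show "aux_poly (T @ T') = (\<Sum>m\<in>matchings n. ?q m * aux_poly (modified_closure T v (E m)))" .
  qed
qed

end
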